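(* Let $f:\mathbb{R}^n\to\mathbb{R}^n$ be a $C^\infty$ vector field, let $z_0\in\mathbb{R}^n$, and let $\varphi_h^f(z_0)$ be the exact solution after time $h$ of $\dot z=f(z)$ with initial value $z_0$. Let $\Phi_h(z_0)=z_1$ be the numerical solution given by the sixth order AVF method $$z_1=z_0+\Big\{hI-\frac{h^3}{12}A_0+\frac{h^5}{720}\Big[6A_1-A_2+A_3-A_4-\frac32A_5-\frac32A_6+3A_7+3A_8\Big]\Big\}\int_0^1 f(\xi z_1+(1-\xi)z_0)\,d\xi ,$$ where $I$ is the $n\times n$ identity matrix and $A_0,\ldots,A_8$ are the $n\times n$ matrices defined by their action on $w\in\mathbb{R}^n$, with $f$ and all its derivatives $f',f'',f'''$ evaluated at the midpoint $\hat z=\frac{z_0+z_1}{2}$: $$A_0w=f'f'w,\quad A_1w=f'f'f'f'w,\quad A_2w=f''(f''(w,f),f),$$ $$A_3w=f'f'f''(w,f),\quad A_4w=f''(f'f'w,f),\quad A_5w=f'f'''(w,f,f),$$ $$A_6w=f'''(f'w,f,f),\quad A_7w=f''(f'w,f'f),\quad A_8w=f'f''(w,f'f).$$ Then $$\|\Phi_h(z_0)-\varphi_h^f(z_0)\|=\mathcal{O}(h^7)\qquad (h\to0).$$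
   Context: $f^{(m)}(\hat z)$ denotes the $m$-th derivative of $f$ at $\hat z$, regarded as a symmetric $m$-linear map $(\mathbb{R}^n)^m\to\mathbb{R}^n$. The method is implicit: for sufficiently small $|h|$, $z_1=\Phi_h(z_0)$ is the solution of the defining equation near $z_0$ (the smooth branch $h\mapsto z_1(h)$ with $z_1(0)=z_0$). *)

theory Defs
  imports "HOL-Analysis.Analysis" "HOL-Library.Landau_Symbols"
begin

(* mderiv f [v1, ..., vm] x is the m-th derivative of f at x applied to (v1, ..., vm).  It is
   obtained by iterating Frechet derivatives, starting with vm; for smooth f the order of the
   arguments is irrelevant. *)
primrec mderiv ::
    "('a::euclidean_space \<Rightarrow> 'b::euclidean_space) \<Rightarrow> 'a list \<Rightarrow> 'a \<Rightarrow> 'b" where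
  "mderiv f [] x = f x"
| "mderiv f (v # vs) x = frechet_derivative (mderiv f vs) (at x) v"

(* C-infinity on S, intended for open S.  Differentiability of all iterated derivatives already
   makes all of them continuous. *)
definition smooth_on ::
    "'a set \<Rightarrow> ('a::euclidean_space \<Rightarrow> 'b::euclidean_space) \<Rightarrow> bool" where
  "smooth_on S f \<longleftrightarrow> (\<forall>vs. \<forall>x\<in>S. mderiv f vs differentiable (at x))"

(* phi is the solution t |-> phi_t(z0) of z' = f(z), z(0) = z0, on some open interval around 0
   (the flow need not be complete); its values elsewhere are unconstrained. *)
definition exact_solution ::
    "(real ^ 'n \<Rightarrow> real ^ 'n) \<Rightarrow> real ^ 'n \<Rightarrow> (real \<Rightarrow> real ^ 'n) \<Rightarrow> bool" where
  "exact_solution f z0 \<phi> \<longleftrightarrow> \<phi> 0 = z0 \<and>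
     (\<exists>\<epsilon>>0. \<forall>t\<in>{-\<epsilon><..<\<epsilon>}. (\<phi> has_vector_derivative f (\<phi> t)) (at t))"

context
  fixes f :: "real ^ 'n \<Rightarrow> real ^ 'n" and z :: "real ^ 'n"
begin

definition avf_A0 :: "real ^ 'n ^ 'n" where
  "avf_A0 = (let D = (\<lambda>vs. mderiv f vs z) in
     matrix (\<lambda>w. D [D [w]]))"

definition avf_A1 :: "real ^ 'n ^ 'n" where
  "avf_A1 = (let D = (\<lambda>vs. mderiv f vs z) in
     matrix (\<lambda>w. D [D [D [D [w]]]]))"

definition avf_A2 :: "real ^ 'n ^ 'n" where
  "avf_A2 = (let D = (\<lambda>vs. mderiv f vs z) in
     matrix (\<lambda>w. D [D [w, f z], f z]))"

definition avf_A3 :: "real ^ 'n ^ 'n" where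
  "avf_A3 = (let D = (\<lambda>vs. mderiv f vs z) in
     matrix (\<lambda>w. D [D [D [w, f z]]]))"

definition avf_A4 :: "real ^ 'n ^ 'n" where
  "avf_A4 = (let D = (\<lambda>vs. mderiv f vs z) in
     matrix (\<lambda>w. D [D [D [w]], f z]))"

definition avf_A5 :: "real ^ 'n ^ 'n" where
  "avf_A5 = (let D = (\<lambda>vs. mderiv f vs z) in
     matrix (\<lambda>w. D [D [w, f z, f z]]))"

definition avf_A6 :: "real ^ 'n ^ 'n" where
  "avf_A6 = (let D = (\<lambda>vs. mderiv f vs z) in
     matrix (\<lambda>w. D [D [w], f z, f z]))"

definition avf_A7 :: "real ^ 'n ^ 'n" where
  "avf_A7 = (let D = (\<lambda>vs. mderiv f vs z) in
     matrix (\<lambda>w. D [D [w], D [f z]]))"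

definition avf_A8 :: "real ^ 'n ^ 'n" where
  "avf_A8 = (let D = (\<lambda>vs. mderiv f vs z) in
     matrix (\<lambda>w. D [D [w, D [f z]]]))"

end

(* The matrix in braces; z is the midpoint of z0 and z1. *)
definition avf6_matrix ::
    "(real ^ 'n \<Rightarrow> real ^ 'n) \<Rightarrow> real \<Rightarrow> real ^ 'n \<Rightarrow> real ^ 'n ^ 'n" where
  "avf6_matrix f h z =
     h *\<^sub>R mat 1 - (h ^ 3 / 12) *\<^sub>R avf_A0 f z
     + (h ^ 5 / 720) *\<^sub>R
         (6 *\<^sub>R avf_A1 f z - avf_A2 f z + avf_A3 f z - avf_A4 f z
          - (3 / 2) *\<^sub>R avf_A5 f z - (3 / 2) *\<^sub>R avf_A6 f z
          + 3 *\<^sub>R avf_A7 f z + 3 *\<^sub>R avf_A8 f z)"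

definition avf6_equation ::
    "(real ^ 'n \<Rightarrow> real ^ 'n) \<Rightarrow> real \<Rightarrow> real ^ 'n \<Rightarrow> real ^ 'n \<Rightarrow> bool" where
  "avf6_equation f h z0 z1 \<longleftrightarrow>
     z1 = z0 + avf6_matrix f h ((1 / 2) *\<^sub>R (z0 + z1)) *v
                 integral {0..1} (\<lambda>\<xi>. f (\<xi> *\<^sub>R z1 + (1 - \<xi>) *\<^sub>R z0))"

(* Phi is the smooth branch h |-> Phi_h(z0) of solutions of the implicit equation through z0,
   defined for all sufficiently small |h|. *)
definition avf6_solution ::
    "(real ^ 'n \<Rightarrow> real ^ 'n) \<Rightarrow> real ^ 'n \<Rightarrow> (real \<Rightarrow> real ^ 'n) \<Rightarrow> bool" where
  "avf6_solution f z0 \<Phi> \<longleftrightarrow> \<Phi> 0 = z0 \<and>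
     (\<exists>\<epsilon>>0. smooth_on {-\<epsilon><..<\<epsilon>} \<Phi> \<and>
        (\<forall>h\<in>{-\<epsilon><..<\<epsilon>}. avf6_equation f h z0 (\<Phi> h)))"

end

theory Submission
  imports Defs
begin

text \<open>
  Because the right-hand side of the method is Lipschitz in the new point with constant
  \<open>O(h)\<close>, it suffices that the exact solution satisfies the defining equation up to
  \<open>O(h\<^sup>7)\<close>. For this, centre the step: with \<open>k = h/2\<close>, let \<open>m\<close> and \<open>d\<close> be the half sum and the
  half difference of \<open>\<phi>(t + k)\<close> and \<open>\<phi>(t - k)\<close>. As functions of \<open>k\<close> they satisfy
  \<open>2 m' = f(m + d) - f(m - d)\<close> and \<open>2 d' = f(m + d) + f(m - d)\<close>, so only odd powers of \<open>k\<close> occur in the expansion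
  \<open>d = k f + k\<^sup>3 c\<^sub>3 + k\<^sup>5 c\<^sub>5 + O(k\<^sup>7)\<close> with coefficients evaluated at the midpoint \<open>m\<close>. The coefficients are found
  successively: the derivative in \<open>k\<close> of the difference of both sides vanishes to one order less.
  Inserting this and \<open>\<integral> f = f + f''(d,d)/6 + f''''(d,d,d,d)/120 + O(k\<^sup>6)\<close> into the method leaves
  a linear identity between the elementary differentials of order five. Finally \<open>t = k = h/2\<close>,
  which is why all estimates are uniform in \<open>t\<close>.
\<close>

section \<open>Iterated Frechet derivatives\<close>

text \<open>Tying \<open>t\<close> to \<open>k\<close> from the start would pin one end of the chord
  and destroy the parity in \<open>k\<close>. So \<open>t\<close> stays a free parameter while
  derivatives in \<open>k\<close> are taken. Half sum and half difference form a closed system, so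
  no higher derivative of \<phi> is ever formed: each expansion comes from integrating a bound in
  \<open>k\<close> from \<open>k = 0\<close>, where d = 0. The difficulty is that the coefficients
  sit at m, which itself moves with \<open>k\<close>: differentiating k^3 c_3(m) creates a term of
  order k^4 that enters c_5. The other obstacle is \<open>mderiv\<close>: iterating Frechet
  derivatives gives linearity only in the head of the list and no visible symmetry, so linearity in
  every slot and symmetry of the second derivative come first. With h = 2k the constants h^3/12 and
  h^5/720 of the method, halved because d is half the increment, become k^3/3 and k^5/45.\<close>

lemma mderiv_append: "mderiv f (us @ vs) = mderiv (mderiv f vs) us"
proof (induction us)
  case Nil
  show ?case by (rule ext) simp
next
  case (Cons u us)
  then show ?case by (intro ext) simp
qed

lemma smooth_mderiv: "smooth_on UNIV f \<Longrightarrow> smooth_on UNIV (mderiv f vs)"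
  by (simp add: smooth_on_def mderiv_append[symmetric])

lemma has_derivative_mderiv:
  assumes "smooth_on UNIV f"
  shows "(mderiv f vs has_derivative (\<lambda>v. mderiv f (v # vs) x)) (at x within S)"
proof -
  have "mderiv f vs differentiable (at x)"
    using assms by (simp add: smooth_on_def)
  then have "(mderiv f vs has_derivative frechet_derivative (mderiv f vs) (at x)) (at x)"
    by (simp add: frechet_derivative_works)
  then show ?thesis
    by (simp add: has_derivative_at_withinI)
qed

lemma continuous_on_mderiv: "smooth_on UNIV f \<Longrightarrow> continuous_on S (mderiv f vs)"
  by (meson has_derivative_continuous_on has_derivative_mderiv)

lemma mderiv_sum:
  assumes "\<And>i. i \<in> I \<Longrightarrow> smooth_on UNIV (g i)"
  shows "mderiv (\<lambda>x. \<Sum>i\<in>I. c i *\<^sub>R g i x) vs = (\<lambda>x. \<Sum>i\<in>I. c i *\<^sub>R mderiv (g i) vs x)"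
proof (induction vs)
  case Nil
  show ?case by (rule ext) simp
next
  case (Cons v vs)
  show ?case
  proof
    fix x
    have "((\<lambda>x. \<Sum>i\<in>I. c i *\<^sub>R mderiv (g i) vs x) has_derivative
        (\<lambda>v. \<Sum>i\<in>I. c i *\<^sub>R mderiv (g i) (v # vs) x)) (at x)"
      by (intro has_derivative_sum has_derivative_scaleR_right has_derivative_mderiv assms)
    from frechet_derivative_at[OF this, symmetric]
    show "mderiv (\<lambda>x. \<Sum>i\<in>I. c i *\<^sub>R g i x) (v # vs) x = (\<Sum>i\<in>I. c i *\<^sub>R mderiv (g i) (v # vs) x)"
      by (simp only: mderiv.simps(2)[of _ v] Cons)
  qed
qed

text \<open>Linearity is built in only for the direction differentiated last, the head. For an inner
  slot, \<open>v\<close> is expanded while it still heads the shorter list, and the finite sum with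
  constant coefficients is then differentiated termwise in the directions \<open>us\<close>.\<close>

lemma mderiv_expand:
  assumes "smooth_on UNIV f"
  shows "mderiv f (us @ v # vs) x = (\<Sum>b\<in>Basis. (v \<bullet> b) *\<^sub>R mderiv f (us @ b # vs) x)"
proof -
  have "mderiv f (v # vs) = (\<lambda>x. \<Sum>b\<in>Basis. (v \<bullet> b) *\<^sub>R mderiv f (b # vs) x)"
  proof
    fix x
    have lin: "linear (\<lambda>v. mderiv f (v # vs) x)"
      using has_derivative_linear[OF has_derivative_mderiv[OF assms]] .
    have "mderiv f ((\<Sum>b\<in>Basis. (v \<bullet> b) *\<^sub>R b) # vs) x
        = (\<Sum>b\<in>Basis. (v \<bullet> b) *\<^sub>R mderiv f (b # vs) x)"
      by (simp only: linear_sum[OF lin] linear_scale[OF lin])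
    then show "mderiv f (v # vs) x = (\<Sum>b\<in>Basis. (v \<bullet> b) *\<^sub>R mderiv f (b # vs) x)"
      by (simp only: euclidean_representation)
  qed
  then have "mderiv f (us @ v # vs)
      = mderiv (\<lambda>x. \<Sum>b\<in>Basis. (v \<bullet> b) *\<^sub>R mderiv f (b # vs) x) us"
    by (simp only: mderiv_append)
  also have "\<dots> = (\<lambda>x. \<Sum>b\<in>Basis. (v \<bullet> b) *\<^sub>R mderiv (mderiv f (b # vs)) us x)"
    by (intro mderiv_sum smooth_mderiv assms)
  finally show ?thesis
    by (simp only: mderiv_append)
qed

lemma linear_mderiv:
  assumes "smooth_on UNIV f"
  shows "linear (\<lambda>v. mderiv f (us @ v # vs) x)"
proof (rule linearI)
  note e = mderiv_expand[OF assms, of us _ vs x]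
  show "mderiv f (us @ (v + w) # vs) x = mderiv f (us @ v # vs) x + mderiv f (us @ w # vs) x" for v w
    unfolding e[of "v + w"] e[of v] e[of w]
    by (simp only: inner_left_distrib scaleR_left_distrib sum.distrib)
  show "mderiv f (us @ (c *\<^sub>R v) # vs) x = c *\<^sub>R mderiv f (us @ v # vs) x" for c v
    unfolding e[of "c *\<^sub>R v"] e[of v]
    by (simp only: inner_scaleR_left scaleR_sum_right scaleR_scaleR)
qed

lemma mderiv_snoc_expand:
  assumes "smooth_on UNIV f"
  shows "mderiv f (us @ [v]) x = (\<Sum>b\<in>Basis. (v \<bullet> b) *\<^sub>R mderiv (mderiv f [b]) us x)"
  using mderiv_expand[OF assms, of us v "[]"] by (simp only: mderiv_append)

text \<open>Expanding the last argument in the basis turns an (n+1)-fold derivative of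
  \<open>f\<close> into n-fold derivatives of the finitely many smooth functions
  \<open>mderiv f [b]\<close>; hence the induction varies \<open>f\<close>. Compactness of the ball
  enters at n = 0.\<close>

lemma mderiv_bound:
  assumes "smooth_on UNIV f"
  shows "\<exists>B\<ge>0. \<forall>x\<in>cball a r. \<forall>vs. length vs = n \<longrightarrow>
           norm (mderiv f vs x) \<le> B * prod_list (map norm vs)"
  using assms
proof (induction n arbitrary: f)
  case 0
  have "compact (mderiv f [] ` cball a r)"
    by (intro compact_continuous_image continuous_on_mderiv 0) auto
  then obtain B where B: "\<And>y. y \<in> mderiv f [] ` cball a r \<Longrightarrow> norm y \<le> B"
    using compact_imp_bounded bounded_iff by metis
  show ?case
    by (rule exI[of _ "max B 0"]) (use B in \<open>force simp: le_max_iff_disj\<close>)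
next
  case (Suc n)
  have "\<forall>b. \<exists>B\<ge>0. \<forall>x\<in>cball a r. \<forall>vs. length vs = n \<longrightarrow>
      norm (mderiv (mderiv f [b]) vs x) \<le> B * prod_list (map norm vs)"
    using Suc.IH[OF smooth_mderiv[OF Suc.prems]] by blast
  then obtain B where B0: "\<And>b. B b \<ge> 0"
    and B: "\<And>b x vs. x \<in> cball a r \<Longrightarrow> length vs = n \<Longrightarrow>
      norm (mderiv (mderiv f [b]) vs x) \<le> B b * prod_list (map norm vs)"
    by metis
  show ?case
  proof (intro exI[of _ "\<Sum>b\<in>Basis. B b"] conjI ballI allI impI)
    show "0 \<le> (\<Sum>b\<in>Basis. B b)" by (intro sum_nonneg B0)
    fix x and vs :: "'a list"
    assume x: "x \<in> cball a r" and "length vs = Suc n"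
    then obtain us v where vs: "vs = us @ [v]" and us: "length us = n"
      by (metis length_append_singleton nat.inject rev_exhaust list.size(3) nat.distinct(1))
    have P0: "0 \<le> prod_list (map norm us)"
      by (induction us) auto
    have "norm (mderiv f vs x) \<le> (\<Sum>b\<in>Basis. norm v * (B b * prod_list (map norm us)))"
      unfolding vs mderiv_snoc_expand[OF Suc.prems]
      by (intro sum_norm_le)
        (auto intro!: mult_mono B x us simp: Basis_le_norm)
    then show "norm (mderiv f vs x) \<le> (\<Sum>b\<in>Basis. B b) * prod_list (map norm vs)"
      by (simp add: vs sum_distrib_left sum_distrib_right mult_ac)
  qed
qed

section \<open>Mean value inequality and Taylor's formula with a uniform remainder\<close>

lemma norm_diff_le_vector_derivative:
  fixes f :: "real \<Rightarrow> 'a::real_normed_vector"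
  assumes "convex S"
    and "\<And>x. x \<in> S \<Longrightarrow> (f has_vector_derivative f' x) (at x within S)"
    and "\<And>x. x \<in> S \<Longrightarrow> norm (f' x) \<le> B"
    and "x \<in> S" "y \<in> S"
  shows "norm (f x - f y) \<le> B * norm (x - y)"
proof (rule differentiable_bound[OF assms(1) _ _ assms(4,5)])
  fix z assume z: "z \<in> S"
  show "(f has_derivative (\<lambda>h. h *\<^sub>R f' z)) (at z within S)"
    using assms(2)[OF z] by (simp add: has_vector_derivative_def)
  show "onorm (\<lambda>h. h *\<^sub>R f' z) \<le> B"
    using assms(3)[OF z] by (simp add: onorm_scaleR_left[OF bounded_linear_ident] onorm_id)
qed

text \<open>Repeated mean value inequality: the derivative of the remainder is the remainder, one
  order lower, of the shifted family \<open>g (Suc j)\<close>, and the remainder vanishes at 0. The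
  factor 1/n! is given away.\<close>

lemma taylor_remainder_bound:
  fixes g :: "nat \<Rightarrow> real \<Rightarrow> 'a::real_normed_vector"
  assumes "\<And>j s. s \<in> {0..1} \<Longrightarrow> (g j has_vector_derivative g (Suc j) s) (at s within {0..1})"
    and "\<And>s. s \<in> {0..1} \<Longrightarrow> norm (g n s) \<le> B"
    and "s \<in> {0..1}"
  shows "norm (g 0 s - (\<Sum>j<n. (s ^ j / fact j) *\<^sub>R g j 0)) \<le> B"
  using assms
proof (induction n arbitrary: g s)
  case 0
  then show ?case by simp
next
  case (Suc n)
  let ?r = "\<lambda>s. g 0 s - (\<Sum>j<Suc n. (s ^ j / fact j) *\<^sub>R g j 0)"
  let ?r' = "\<lambda>s. g 1 s - (\<Sum>j<n. (s ^ j / fact j) *\<^sub>R g (Suc j) 0)"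
  have "(?r has_vector_derivative ?r' s) (at s within {0..1})" if "s \<in> {0..1}" for s
  proof -
    have "((\<lambda>s. s ^ Suc j / fact (Suc j)) has_real_derivative s ^ j / fact j) (at s within {0..1})" for j
    proof -
      have "((\<lambda>s. s ^ Suc j / fact (Suc j)) has_real_derivative
          real (Suc j) * s ^ (Suc j - Suc 0) / fact (Suc j)) (at s within {0..1})"
        by (intro DERIV_cdivide DERIV_pow)
      then show ?thesis by (simp del: of_nat_Suc)
    qed
    then have "((\<lambda>s. (s ^ Suc j / fact (Suc j)) *\<^sub>R g (Suc j) 0) has_vector_derivative
        (s ^ j / fact j) *\<^sub>R g (Suc j) 0) (at s within {0..1})" for j
      by (intro has_vector_derivative_scaleR[where g' = 0, simplified]) auto
    then have "((\<lambda>s. g 0 s - (g 0 0 + (\<Sum>j<n. (s ^ Suc j / fact (Suc j)) *\<^sub>R g (Suc j) 0)))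
        has_vector_derivative g (Suc 0) s - (0 + (\<Sum>j<n. (s ^ j / fact j) *\<^sub>R g (Suc j) 0)))
        (at s within {0..1})"
      by (intro has_vector_derivative_diff has_vector_derivative_add has_vector_derivative_const
          has_vector_derivative_sum Suc.prems that)
    then show ?thesis
      by (simp only: sum.lessThan_Suc_shift) (simp del: fact_Suc)
  qed
  moreover have "norm (?r' s) \<le> B" if "s \<in> {0..1}" for s
    using Suc.IH[of "\<lambda>j. g (Suc j)" s] Suc.prems(1,2) that by simp
  ultimately have "norm (?r s - ?r 0) \<le> B * norm (s - 0)"
    using Suc.prems(3)
    by (intro norm_diff_le_vector_derivative[of "{0..1}" ?r ?r']) auto
  moreover have "?r 0 = 0"
    by (simp add: sum.lessThan_Suc_shift del: sum.lessThan_Suc)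
  moreover have "0 \<le> B"
    using order_trans[OF norm_ge_zero Suc.prems(2)[of 0]] by simp
  then have "B * norm (s - 0) \<le> B"
    using Suc.prems(3) by (simp add: mult_left_le)
  ultimately show ?case by simp
qed

text \<open>Taylor along the segment from \<open>y\<close> to \<open>y + v\<close>, which stays in
  the ball by convexity. One \<open>B\<close> serves all \<open>y\<close> and \<open>v\<close>; this
  is what later makes the estimates uniform in the centre of the step.\<close>

lemma taylor_mderiv:
  assumes "smooth_on UNIV f"
  shows "\<exists>B\<ge>0. \<forall>y\<in>cball a r. \<forall>v. y + v \<in> cball a r \<longrightarrow>
           norm (f (y + v) - (\<Sum>j<n. (1 / fact j) *\<^sub>R mderiv f (replicate j v) y)) \<le> B * norm v ^ n"
proof -
  obtain B where B: "B \<ge> 0" "\<And>x vs. x \<in> cball a r \<Longrightarrow> length vs = n \<Longrightarrow>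
      norm (mderiv f vs x) \<le> B * prod_list (map norm vs)"
    using mderiv_bound[OF assms, of a r n] by blast
  have "norm (f (y + v) - (\<Sum>j<n. (1 / fact j) *\<^sub>R mderiv f (replicate j v) y)) \<le> B * norm v ^ n"
    if y: "y \<in> cball a r" "y + v \<in> cball a r" for y v
  proof -
    let ?g = "\<lambda>j s. mderiv f (replicate j v) (y + s *\<^sub>R v)"
    have "y + s *\<^sub>R v \<in> cball a r" if "s \<in> {0..1}" for s
    proof -
      have "(1 - s) *\<^sub>R y + s *\<^sub>R (y + v) \<in> cball a r"
        using that y by (intro convexD convex_cball) auto
      then show ?thesis by (simp add: algebra_simps)
    qed
    then have "norm (?g n s) \<le> B * norm v ^ n" if "s \<in> {0..1}" for s
      using B(2)[of "y + s *\<^sub>R v" "replicate n v"] that by (simp add: prod_list_replicate)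
    moreover have "(?g j has_vector_derivative ?g (Suc j) s) (at s within {0..1})" for j s
    proof -
      have "((\<lambda>s. y + s *\<^sub>R v) has_vector_derivative v) (at s within {0..1})"
        by (auto intro!: derivative_eq_intros)
      from vector_derivative_diff_chain_within[OF this has_derivative_mderiv[OF assms]]
      show ?thesis by (simp add: o_def)
    qed
    ultimately show ?thesis
      using taylor_remainder_bound[of ?g n "B * norm v ^ n" 1] by simp
  qed
  with B(1) show ?thesis by blast
qed

section \<open>Symmetry of the second derivative and differentiation along curves\<close>

text \<open>From here on iterated derivatives are treated as multilinear expressions; unfolding them
  to \<open>frechet_derivative\<close> would get in the way of the linearity rules.\<close>

declare mderiv.simps(2) [simp del]

text \<open>The difference in \<open>v\<close> is kept fixed while the step \<open>r\<close> in
  direction \<open>u\<close> runs over \<open>{0..s}\<close>. The derivative in \<open>r\<close> is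
  a Taylor error in direction \<open>v\<close> plus the drift of the second derivative between
  \<open>x\<close> and \<open>x + r u\<close>, both of size s^2; the mean value inequality adds the
  third power.\<close>

lemma mixed_difference_bound:
  fixes f :: "'a::euclidean_space \<Rightarrow> 'b::euclidean_space"
  assumes f: "smooth_on UNIV f"
  shows "\<exists>C\<ge>0. \<forall>s\<in>{0..1}. norm (f (x + s *\<^sub>R u + s *\<^sub>R v) - f (x + s *\<^sub>R u) - f (x + s *\<^sub>R v) + f x
           - s\<^sup>2 *\<^sub>R mderiv f [v, u] x) \<le> C * s ^ 3"
proof -
  let ?R = "norm u + norm v"
  let ?g = "mderiv f [u]" and ?k = "mderiv f [v, u]"
  obtain B where B: "B \<ge> 0" "\<And>y z. y \<in> cball x ?R \<Longrightarrow> y + z \<in> cball x ?R \<Longrightarrow>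
      norm (?g (y + z) - (\<Sum>j<2. (1 / fact j) *\<^sub>R mderiv ?g (replicate j z) y)) \<le> B * norm z ^ 2"
    using taylor_mderiv[OF smooth_mderiv[OF f, of "[u]"], of x ?R 2] by blast
  obtain L where L: "L \<ge> 0" "\<And>y z. y \<in> cball x ?R \<Longrightarrow> y + z \<in> cball x ?R \<Longrightarrow>
      norm (?k (y + z) - (\<Sum>j<1. (1 / fact j) *\<^sub>R mderiv ?k (replicate j z) y)) \<le> L * norm z ^ 1"
    using taylor_mderiv[OF smooth_mderiv[OF f, of "[v, u]"], of x ?R 1] by blast
  let ?C = "B * norm v ^ 2 + L * norm u"
  have "norm (f (x + s *\<^sub>R u + s *\<^sub>R v) - f (x + s *\<^sub>R u) - f (x + s *\<^sub>R v) + f x - s\<^sup>2 *\<^sub>R ?k x)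
      \<le> ?C * s ^ 3" if s: "s \<in> {0..1}" for s
  proof -
    let ?p = "\<lambda>r. f (x + s *\<^sub>R v + r *\<^sub>R u) - f (x + r *\<^sub>R u) - (r * s) *\<^sub>R ?k x"
    let ?p' = "\<lambda>r. ?g (x + s *\<^sub>R v + r *\<^sub>R u) - ?g (x + r *\<^sub>R u) - s *\<^sub>R ?k x"
    have curve: "((\<lambda>r. f (y + r *\<^sub>R u)) has_vector_derivative ?g (y + r *\<^sub>R u)) (at r within {0..s})" for y r
    proof -
      have "((\<lambda>s. y + s *\<^sub>R u) has_vector_derivative u) (at r within {0..s})"
        by (auto intro!: derivative_eq_intros)
      from vector_derivative_diff_chain_within[OF this has_derivative_mderiv[OF f, of "[]"]]
      show ?thesis by (simp add: o_def)
    qed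
    have "norm (?p s - ?p 0) \<le> (?C * s\<^sup>2) * norm (s - 0)"
    proof (rule norm_diff_le_vector_derivative[of "{0..s}" ?p ?p'])
      fix r assume r: "r \<in> {0..s}"
      have "((\<lambda>r. (r * s) *\<^sub>R ?k x) has_vector_derivative s *\<^sub>R ?k x) (at r within {0..s})"
        by (intro has_vector_derivative_scaleR[where g' = 0, simplified])
          (auto intro!: derivative_eq_intros)
      then show "(?p has_vector_derivative ?p' r) (at r within {0..s})"
        by (intro has_vector_derivative_diff curve)
      let ?y = "x + r *\<^sub>R u"
      have "norm (r *\<^sub>R u) \<le> norm u"
        using r s by (simp add: mult_left_le_one_le)
      moreover have "norm (s *\<^sub>R v) \<le> norm v"
        using s by (simp add: mult_left_le_one_le)
      ultimately have "norm (r *\<^sub>R u) \<le> ?R" "norm (r *\<^sub>R u + s *\<^sub>R v) \<le> ?R"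
        using norm_triangle_mono[of "r *\<^sub>R u" "norm u" "s *\<^sub>R v" "norm v"] norm_ge_zero[of v]
        by linarith+
      then have dom: "?y \<in> cball x ?R" "?y + s *\<^sub>R v \<in> cball x ?R"
        by (simp_all only: mem_cball dist_norm add.assoc norm_minus_commute[of x] add_diff_cancel_left')
      have k: "mderiv ?g [s *\<^sub>R v] ?y = s *\<^sub>R ?k ?y"
        using linear_scale[OF linear_mderiv[OF f, of "[]" "[u]" ?y], of s v]
        by (simp add: mderiv_append[symmetric])
      have "norm (?g (?y + s *\<^sub>R v) - ?g ?y - s *\<^sub>R ?k ?y) \<le> B * (s\<^sup>2 * norm v ^ 2)"
        using B(2)[OF dom] s k by (simp add: numeral_2_eq_2 power_mult_distrib diff_diff_eq mult_ac)
      moreover have "norm (s *\<^sub>R (?k ?y - ?k x)) \<le> s * (L * (s * norm u))"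
      proof -
        have "norm (?k (x + r *\<^sub>R u) - ?k x) \<le> L * (r * norm u)"
          using L(2)[of x "r *\<^sub>R u"] dom(1) r by simp
        also have "\<dots> \<le> L * (s * norm u)"
          using r L(1) by (intro mult_left_mono mult_right_mono) auto
        finally show ?thesis
          using s by (simp add: mult_left_mono)
      qed
      ultimately have "norm ((?g (?y + s *\<^sub>R v) - ?g ?y - s *\<^sub>R ?k ?y) + s *\<^sub>R (?k ?y - ?k x))
          \<le> B * (s\<^sup>2 * norm v ^ 2) + s * (L * (s * norm u))"
        by (rule norm_triangle_mono)
      then show "norm (?p' r) \<le> ?C * s\<^sup>2"
        by (simp add: algebra_simps power2_eq_square)
    qed (use s in auto)
    moreover have "?p s - ?p 0 = f (x + s *\<^sub>R u + s *\<^sub>R v) - f (x + s *\<^sub>R u) - f (x + s *\<^sub>R v) + f x - s\<^sup>2 *\<^sub>R ?k x"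
      by (simp add: power2_eq_square algebra_simps)
    moreover have "(?C * s\<^sup>2) * norm (s - 0) = ?C * s ^ 3"
      using s by (simp add: power2_eq_square power3_eq_cube)
    ultimately show ?thesis by (simp only:)
  qed
  moreover have "?C \<ge> 0" using B(1) L(1) by simp
  ultimately show ?thesis by blast
qed

text \<open>Schwarz's theorem: the second difference \<Delta> is symmetric in \<open>u\<close> and
  \<open>v\<close> and lies within O(s^3) of s^2 times either mixed derivative, so the two differ by
  O(s).\<close>

lemma mderiv_swap2:
  assumes f: "smooth_on UNIV f"
  shows "mderiv f [u, v] x = mderiv f [v, u] x"
proof (rule ccontr)
  assume ne: "mderiv f [u, v] x \<noteq> mderiv f [v, u] x"
  define d where "d = norm (mderiv f [u, v] x - mderiv f [v, u] x)"
  have d: "d > 0" using ne by (simp add: d_def)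
  define \<Delta> where "\<Delta> s = f (x + s *\<^sub>R u + s *\<^sub>R v) - f (x + s *\<^sub>R u) - f (x + s *\<^sub>R v) + f x" for s
  obtain C1 where C1: "C1 \<ge> 0" "\<And>s. s \<in> {0..1} \<Longrightarrow> norm (\<Delta> s - s\<^sup>2 *\<^sub>R mderiv f [v, u] x) \<le> C1 * s ^ 3"
    using mixed_difference_bound[OF f, of x u v] unfolding \<Delta>_def by blast
  have \<Delta>': "\<Delta> s = f (x + s *\<^sub>R v + s *\<^sub>R u) - f (x + s *\<^sub>R v) - f (x + s *\<^sub>R u) + f x" for s
    by (simp add: \<Delta>_def algebra_simps)
  obtain C2 where C2: "C2 \<ge> 0" "\<And>s. s \<in> {0..1} \<Longrightarrow> norm (\<Delta> s - s\<^sup>2 *\<^sub>R mderiv f [u, v] x) \<le> C2 * s ^ 3"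
    using mixed_difference_bound[OF f, of x v u] unfolding \<Delta>' by blast
  \<comment> \<open>Makes (C1 + C2) s smaller than d; the added 1 keeps the denominator positive
    when both constants are 0.\<close>
  define s where "s = min 1 (d / (2 * (C1 + C2 + 1)))"
  have s: "s > 0" "s \<le> 1" "s \<le> d / (2 * (C1 + C2 + 1))"
    using d C1(1) C2(1) by (auto simp: s_def)
  have "norm ((\<Delta> s - s\<^sup>2 *\<^sub>R mderiv f [v, u] x) - (\<Delta> s - s\<^sup>2 *\<^sub>R mderiv f [u, v] x))
      \<le> C1 * s ^ 3 + C2 * s ^ 3"
    using s by (intro order_trans[OF norm_triangle_ineq4] add_mono C1 C2) auto
  also have "(\<Delta> s - s\<^sup>2 *\<^sub>R mderiv f [v, u] x) - (\<Delta> s - s\<^sup>2 *\<^sub>R mderiv f [u, v] x)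
      = s\<^sup>2 *\<^sub>R (mderiv f [u, v] x - mderiv f [v, u] x)"
    by (simp add: algebra_simps)
  finally have "s\<^sup>2 * d \<le> s\<^sup>2 * ((C1 + C2) * s)"
    unfolding norm_scaleR d_def[symmetric]
    by (simp add: algebra_simps power2_eq_square power3_eq_cube)
  then have "d \<le> (C1 + C2) * s"
    using s(1) by simp
  also have "\<dots> \<le> (C1 + C2) * (d / (2 * (C1 + C2 + 1)))"
    using s C1(1) C2(1) by (intro mult_left_mono) auto
  also have "\<dots> < d"
    using d C1(1) C2(1) by (simp add: field_simps add_nonneg_pos)
  finally show False by simp
qed

section \<open>Chain and product rules for iterated derivatives along a curve\<close>

lemma has_vector_derivative_mderiv:
  assumes "smooth_on UNIV f" "(X has_vector_derivative X') (at k within S)"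
  shows "((\<lambda>k. mderiv f vs (X k)) has_vector_derivative mderiv f (X' # vs) (X k)) (at k within S)"
  using vector_derivative_diff_chain_within[OF assms(2) has_derivative_mderiv[OF assms(1), of vs]]
  by (simp only: o_def)

lemma has_vector_derivative_scaleR_const:
  "(g has_vector_derivative g') F \<Longrightarrow> ((\<lambda>k. c *\<^sub>R g k) has_vector_derivative c *\<^sub>R g') F"
  for g :: "real \<Rightarrow> 'a::real_normed_vector"
  by (rule bounded_linear.has_vector_derivative[OF bounded_linear_scaleR_right])

lemma has_vector_derivative_inner_const:
  "(U has_vector_derivative U') (at k within S) \<Longrightarrow>
    ((\<lambda>k. U k \<bullet> b) has_real_derivative U' \<bullet> b) (at k within S)"
  unfolding has_real_derivative_iff_has_vector_derivative
  by (rule bounded_linear.has_vector_derivative[OF bounded_linear_inner_left])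

text \<open>The direction moves along with the base point. In basis coordinates the expression is a
  finite sum of scalar functions times derivatives in fixed directions, where the chain rule for the
  base point applies.\<close>

lemma has_vector_derivative_mderiv1:
  assumes f: "smooth_on UNIV f" and X: "(X has_vector_derivative X') (at k within S)"
    and U: "(U has_vector_derivative U') (at k within S)"
  shows "((\<lambda>k. mderiv f [U k] (X k)) has_vector_derivative
           mderiv f [X', U k] (X k) + mderiv f [U'] (X k)) (at k within S)"
proof -
  have der: "((\<lambda>k. \<Sum>b\<in>Basis. (U k \<bullet> b) *\<^sub>R mderiv f [b] (X k)) has_vector_derivative
      (\<Sum>b\<in>Basis. (U k \<bullet> b) *\<^sub>R mderiv f [X', b] (X k) + (U' \<bullet> b) *\<^sub>R mderiv f [b] (X k))) (at k within S)"
    by (intro has_vector_derivative_sum has_vector_derivative_scaleR has_vector_derivative_mderiv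
        has_vector_derivative_inner_const f X U)
  have e1: "mderiv f [w] y = (\<Sum>b\<in>Basis. (w \<bullet> b) *\<^sub>R mderiv f [b] y)" for w y
    using mderiv_expand[OF f, of "[]" w "[]" y] by simp
  have e2: "mderiv f [X', w] y = (\<Sum>b\<in>Basis. (w \<bullet> b) *\<^sub>R mderiv f [X', b] y)" for w y
    using mderiv_expand[OF f, of "[X']" w "[]" y] by simp
  from der show ?thesis
    by (simp only: sum.distrib e1[symmetric] e2[symmetric])
qed

lemma has_vector_derivative_mderiv2:
  assumes f: "smooth_on UNIV f" and X: "(X has_vector_derivative X') (at k within S)"
    and U: "(U has_vector_derivative U') (at k within S)"
    and V: "(V has_vector_derivative V') (at k within S)"
  shows "((\<lambda>k. mderiv f [U k, V k] (X k)) has_vector_derivative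
           mderiv f [X', U k, V k] (X k) + mderiv f [U', V k] (X k) + mderiv f [U k, V'] (X k)) (at k within S)"
proof -
  have der: "((\<lambda>k. \<Sum>b\<in>Basis. (V k \<bullet> b) *\<^sub>R mderiv (mderiv f [b]) [U k] (X k)) has_vector_derivative
      (\<Sum>b\<in>Basis. (V k \<bullet> b) *\<^sub>R (mderiv (mderiv f [b]) [X', U k] (X k) + mderiv (mderiv f [b]) [U'] (X k))
        + (V' \<bullet> b) *\<^sub>R mderiv (mderiv f [b]) [U k] (X k))) (at k within S)"
    by (intro has_vector_derivative_sum has_vector_derivative_scaleR has_vector_derivative_mderiv1
        has_vector_derivative_inner_const f smooth_mderiv X U V)
  have e1: "mderiv f [u, w] y = (\<Sum>b\<in>Basis. (w \<bullet> b) *\<^sub>R mderiv (mderiv f [b]) [u] y)" for u w y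
    using mderiv_snoc_expand[OF f, of "[u]" w y] by simp
  have e2: "mderiv f [X', u, w] y = (\<Sum>b\<in>Basis. (w \<bullet> b) *\<^sub>R mderiv (mderiv f [b]) [X', u] y)" for u w y
    using mderiv_snoc_expand[OF f, of "[X', u]" w y] by simp
  from der show ?thesis
    by (simp only: sum.distrib scaleR_add_right e1[symmetric] e2[symmetric])
qed

section \<open>Local Lipschitz continuity and uniform orders of vanishing\<close>

text \<open>Used for two things: exchanging the midpoint for the centre inside a coefficient, and
  the dependence of the method on its new point. The property is stable under all operations that
  build elementary differentials.\<close>

definition locally_lipschitz_at :: "'a::metric_space \<Rightarrow> ('a \<Rightarrow> 'b::metric_space) \<Rightarrow> bool" where
  "locally_lipschitz_at x0 g \<longleftrightarrow> (\<exists>r>0. \<exists>L. L-lipschitz_on (cball x0 r) g)"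

lemma locally_lipschitz_at_lipschitz_on:
  assumes "locally_lipschitz_at x0 g"
  shows "\<exists>R>0. \<exists>L. \<forall>r\<le>R. L-lipschitz_on (cball x0 r) g"
  using assms unfolding locally_lipschitz_at_def
  by (meson lipschitz_on_subset subset_cball)

lemma locally_lipschitz_at_obtain2:
  assumes "locally_lipschitz_at x0 g" "locally_lipschitz_at x0 h"
  obtains r L M where "r > 0" "L-lipschitz_on (cball x0 r) g" "M-lipschitz_on (cball x0 r) h"
proof -
  obtain R1 L where 1: "R1 > 0" "\<And>r. r \<le> R1 \<Longrightarrow> L-lipschitz_on (cball x0 r) g"
    using locally_lipschitz_at_lipschitz_on[OF assms(1)] by blast
  obtain R2 M where 2: "R2 > 0" "\<And>r. r \<le> R2 \<Longrightarrow> M-lipschitz_on (cball x0 r) h"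
    using locally_lipschitz_at_lipschitz_on[OF assms(2)] by blast
  show ?thesis
    by (rule that[of "min R1 R2" L M]) (use 1 2 in auto)
qed

lemma locally_lipschitz_at_const: "locally_lipschitz_at x0 (\<lambda>x. c)"
  unfolding locally_lipschitz_at_def using lipschitz_on_constant zero_less_one by blast

lemma locally_lipschitz_at_add:
  fixes g h :: "'a::metric_space \<Rightarrow> 'b::real_normed_vector"
  shows "locally_lipschitz_at x0 g \<Longrightarrow> locally_lipschitz_at x0 h \<Longrightarrow> locally_lipschitz_at x0 (\<lambda>x. g x + h x)"
  by (rule locally_lipschitz_at_obtain2[of x0 g h], assumption+)
    (auto simp: locally_lipschitz_at_def intro: lipschitz_on_add)

lemma locally_lipschitz_at_diff:
  fixes g h :: "'a::metric_space \<Rightarrow> 'b::real_normed_vector"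
  shows "locally_lipschitz_at x0 g \<Longrightarrow> locally_lipschitz_at x0 h \<Longrightarrow> locally_lipschitz_at x0 (\<lambda>x. g x - h x)"
  by (rule locally_lipschitz_at_obtain2[of x0 g h], assumption+)
    (auto simp: locally_lipschitz_at_def intro: lipschitz_on_diff)

lemma locally_lipschitz_at_sum:
  fixes g :: "'i \<Rightarrow> 'a::metric_space \<Rightarrow> 'b::real_normed_vector"
  shows "(\<And>i. i \<in> I \<Longrightarrow> locally_lipschitz_at x0 (g i)) \<Longrightarrow> locally_lipschitz_at x0 (\<lambda>x. \<Sum>i\<in>I. g i x)"
  by (induction I rule: infinite_finite_induct)
    (auto intro: locally_lipschitz_at_const locally_lipschitz_at_add)

lemma locally_lipschitz_at_bounded_linear:
  assumes "bounded_linear T" "locally_lipschitz_at x0 g"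
  shows "locally_lipschitz_at x0 (\<lambda>x. T (g x))"
proof -
  obtain r L where r: "r > 0" "L-lipschitz_on (cball x0 r) g"
    using assms(2) by (auto simp: locally_lipschitz_at_def)
  obtain B where "B-lipschitz_on (g ` cball x0 r) T"
    using bounded_linear.lipschitz_boundE[OF assms(1)] by blast
  then have "(B * L)-lipschitz_on (cball x0 r) (\<lambda>x. T (g x))"
    using lipschitz_on_compose2[OF r(2)] by blast
  with r(1) show ?thesis by (auto simp: locally_lipschitz_at_def)
qed

lemma locally_lipschitz_at_scaleR:
  fixes g :: "'a::metric_space \<Rightarrow> 'b::real_normed_vector"
  assumes "locally_lipschitz_at x0 a" "locally_lipschitz_at x0 g"
  shows "locally_lipschitz_at x0 (\<lambda>x. a x *\<^sub>R g x)"
proof -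
  obtain r L M where r: "r > 0" and a: "L-lipschitz_on (cball x0 r) a" and g: "M-lipschitz_on (cball x0 r) g"
    using locally_lipschitz_at_obtain2[OF assms] .
  have L: "L \<ge> 0" and M: "M \<ge> 0"
    using a g lipschitz_on_nonneg by blast+
  \<comment> \<open>From a(x) g(x) - a(y) g(y) = a(x) (g(x) - g(y)) + (a(x) - a(y)) g(y), each
    factor being bounded by its value at the centre plus Lipschitz constant times radius.\<close>
  have "((norm (a x0) + L * r) * M + L * (norm (g x0) + M * r))-lipschitz_on (cball x0 r) (\<lambda>x. a x *\<^sub>R g x)"
  proof (rule lipschitz_onI)
    fix x y assume x: "x \<in> cball x0 r" and y: "y \<in> cball x0 r"
    have x0: "x0 \<in> cball x0 r" using r by simp
    have bnd: "norm (h z) \<le> norm (h x0) + K * r" if "K-lipschitz_on (cball x0 r) h" "z \<in> cball x0 r"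
      for h :: "'a \<Rightarrow> 'c::real_normed_vector" and K z
    proof -
      have "norm (h z) \<le> norm (h x0) + norm (h z - h x0)"
        by (rule norm_triangle_sub)
      also have "norm (h z - h x0) \<le> K * dist z x0"
        using lipschitz_onD[OF that x0] by (simp add: dist_norm)
      also have "K * dist z x0 \<le> K * r"
        using that lipschitz_on_nonneg[OF that(1)] by (auto intro!: mult_left_mono simp: dist_commute)
      finally show ?thesis by simp
    qed
    have "dist (a x *\<^sub>R g x) (a y *\<^sub>R g y) = norm (a x *\<^sub>R (g x - g y) + (a x - a y) *\<^sub>R g y)"
      by (simp add: dist_norm algebra_simps)
    also have "\<dots> \<le> norm (a x) * norm (g x - g y) + norm (a x - a y) * norm (g y)"
      by (rule order_trans[OF norm_triangle_ineq]) simp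
    also have "\<dots> \<le> (norm (a x0) + L * r) * (M * dist x y) + (L * dist x y) * (norm (g x0) + M * r)"
      using bnd[OF a x] bnd[OF g y] lipschitz_onD[OF a x y] lipschitz_onD[OF g x y] L M r
      by (intro add_mono mult_mono) (auto simp: dist_norm)
    finally show "dist (a x *\<^sub>R g x) (a y *\<^sub>R g y)
        \<le> ((norm (a x0) + L * r) * M + L * (norm (g x0) + M * r)) * dist x y"
      by (simp add: algebra_simps)
  qed (use L M r in \<open>auto intro!: add_nonneg_nonneg mult_nonneg_nonneg\<close>)
  with r show ?thesis by (auto simp: locally_lipschitz_at_def)
qed

lemma locally_lipschitz_at_ident: "locally_lipschitz_at x0 (\<lambda>x. x)"
  unfolding locally_lipschitz_at_def using lipschitz_on_id zero_less_one by blast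

lemma locally_lipschitz_at_scale:
  fixes g :: "'a::metric_space \<Rightarrow> 'b::real_normed_vector"
  shows "locally_lipschitz_at x0 g \<Longrightarrow> locally_lipschitz_at x0 (\<lambda>x. c *\<^sub>R g x)"
  by (rule locally_lipschitz_at_scaleR[OF locally_lipschitz_at_const])

lemma locally_lipschitz_at_compose:
  assumes "locally_lipschitz_at x0 m" "locally_lipschitz_at (m x0) g"
  shows "locally_lipschitz_at x0 (\<lambda>x. g (m x))"
proof -
  obtain R L where R: "R > 0" "\<And>r. r \<le> R \<Longrightarrow> L-lipschitz_on (cball x0 r) m"
    using locally_lipschitz_at_lipschitz_on[OF assms(1)] by blast
  obtain s M where s: "s > 0" "M-lipschitz_on (cball (m x0) s) g"
    using assms(2) by (auto simp: locally_lipschitz_at_def)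
  have L: "L \<ge> 0" using R(2) lipschitz_on_nonneg by blast
  \<comment> \<open>On this radius \<open>m\<close> maps into the ball of radius \<open>s\<close>
    where \<open>g\<close> is Lipschitz; \<open>L + 1\<close> avoids division by 0.\<close>
  define r where "r = min R (s / (L + 1))"
  have r: "r > 0" "r \<le> R" "r \<le> s / (L + 1)"
    using R(1) s(1) L by (auto simp: r_def)
  have "L * r \<le> L * (s / (L + 1))" using r L by (intro mult_left_mono) auto
  also have "\<dots> \<le> s" using L s(1) by (simp add: field_simps)
  finally have Lr: "L * r \<le> s" .
  have "m ` cball x0 r \<subseteq> cball (m x0) s"
  proof safe
    fix x assume x: "x \<in> cball x0 r"
    have "dist (m x0) (m x) \<le> L * dist x0 x"
      using lipschitz_onD[OF R(2)[OF r(2)], of x0 x] x r(1) by simp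
    also have "\<dots> \<le> L * r" using x L by (intro mult_left_mono) auto
    finally show "m x \<in> cball (m x0) s" using Lr by simp
  qed
  then have "(M * L)-lipschitz_on (cball x0 r) (\<lambda>x. g (m x))"
    using lipschitz_on_compose2[OF R(2)[OF r(2)]] lipschitz_on_subset[OF s(2)] by blast
  with r(1) show ?thesis by (auto simp: locally_lipschitz_at_def)
qed

lemma lipschitz_on_cball_smooth:
  fixes f :: "'a::euclidean_space \<Rightarrow> 'b::euclidean_space"
  assumes "smooth_on UNIV f"
  shows "\<exists>L. L-lipschitz_on (cball x0 r) f"
proof -
  obtain B where B: "B \<ge> 0" "\<And>y v. y \<in> cball x0 r \<Longrightarrow> y + v \<in> cball x0 r \<Longrightarrow>
      norm (f (y + v) - (\<Sum>j<1. (1 / fact j) *\<^sub>R mderiv f (replicate j v) y)) \<le> B * norm v ^ 1"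
    using taylor_mderiv[OF assms, of x0 r 1] by blast
  have "B-lipschitz_on (cball x0 r) f"
  proof (rule lipschitz_onI)
    fix x y assume "x \<in> cball x0 r" "y \<in> cball x0 r"
    then show "dist (f x) (f y) \<le> B * dist x y"
      using B(2)[of y "x - y"] by (simp add: dist_norm)
  qed (use B in simp)
  then show ?thesis by blast
qed

text \<open>Peeling off the last argument in basis coordinates leaves Lipschitz scalars times
  shorter derivatives of \<open>mderiv f [b]\<close>, so again \<open>f\<close> varies in the
  induction.\<close>

lemma locally_lipschitz_at_mderiv_map:
  fixes f :: "'a::euclidean_space \<Rightarrow> 'b::euclidean_space"
  assumes "smooth_on UNIV f" "locally_lipschitz_at x0 m" "\<And>u. u \<in> set us \<Longrightarrow> locally_lipschitz_at x0 u"
  shows "locally_lipschitz_at x0 (\<lambda>x. mderiv f (map (\<lambda>u. u x) us) (m x))"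
  using assms
proof (induction us arbitrary: f rule: rev_induct)
  case Nil
  have "locally_lipschitz_at (m x0) f"
    unfolding locally_lipschitz_at_def
    using lipschitz_on_cball_smooth[OF Nil(1), of "m x0" 1] zero_less_one by blast
  with Nil show ?case
    by (simp add: locally_lipschitz_at_compose)
next
  case (snoc u us)
  have "locally_lipschitz_at x0
      (\<lambda>x. \<Sum>b\<in>Basis. (u x \<bullet> b) *\<^sub>R mderiv (mderiv f [b]) (map (\<lambda>u. u x) us) (m x))"
    using snoc.prems
    by (intro locally_lipschitz_at_sum locally_lipschitz_at_scaleR snoc.IH smooth_mderiv
        locally_lipschitz_at_bounded_linear[OF bounded_linear_inner_left]) auto
  then show ?case
    by (simp only: map_append list.map mderiv_snoc_expand[OF snoc.prems(1)])
qed

lemma locally_lipschitz_at_mderiv: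
  assumes "smooth_on UNIV f" "locally_lipschitz_at x0 m"
  shows "locally_lipschitz_at x0 (\<lambda>x. f (m x))"
    and "locally_lipschitz_at x0 u \<Longrightarrow> locally_lipschitz_at x0 (\<lambda>x. mderiv f [u x] (m x))"
    and "locally_lipschitz_at x0 u \<Longrightarrow> locally_lipschitz_at x0 v \<Longrightarrow>
      locally_lipschitz_at x0 (\<lambda>x. mderiv f [u x, v x] (m x))"
    and "locally_lipschitz_at x0 u \<Longrightarrow> locally_lipschitz_at x0 v \<Longrightarrow> locally_lipschitz_at x0 w \<Longrightarrow>
      locally_lipschitz_at x0 (\<lambda>x. mderiv f [u x, v x, w x] (m x))"
    and "locally_lipschitz_at x0 u \<Longrightarrow> locally_lipschitz_at x0 v \<Longrightarrow> locally_lipschitz_at x0 w \<Longrightarrow>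
      locally_lipschitz_at x0 z \<Longrightarrow> locally_lipschitz_at x0 (\<lambda>x. mderiv f [u x, v x, w x, z x] (m x))"
  using locally_lipschitz_at_mderiv_map[OF assms, of "[]"]
    locally_lipschitz_at_mderiv_map[OF assms, of "[u]"]
    locally_lipschitz_at_mderiv_map[OF assms, of "[u, v]"]
    locally_lipschitz_at_mderiv_map[OF assms, of "[u, v, w]"]
    locally_lipschitz_at_mderiv_map[OF assms, of "[u, v, w, z]"]
  by force+

text \<open>A pair \<open>p = (t, k)\<close> stands for centre and half step: the estimate is \<open>O(k\<^sup>n)\<close> uniformly for \<open>t\<close> near 0.\<close>

definition vanishes :: "nat \<Rightarrow> (real \<times> real \<Rightarrow> 'a::real_normed_vector) \<Rightarrow> bool" where
  "vanishes n e \<longleftrightarrow> (\<exists>C. \<forall>\<^sub>F p in nhds 0. norm (e p) \<le> C * \<bar>snd p\<bar> ^ n)"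

section \<open>Arithmetic of orders of vanishing\<close>

lemma vanishesE:
  assumes "vanishes n e"
  obtains C where "C \<ge> 0" "\<forall>\<^sub>F p in nhds 0. norm (e p) \<le> C * \<bar>snd p\<bar> ^ n"
proof -
  obtain C where C: "\<forall>\<^sub>F p in nhds 0. norm (e p) \<le> C * \<bar>snd p\<bar> ^ n"
    using assms by (auto simp: vanishes_def)
  have "\<forall>\<^sub>F p in nhds 0. norm (e p) \<le> max C 0 * \<bar>snd p\<bar> ^ n"
    using C by eventually_elim (erule order_trans, intro mult_right_mono, auto)
  then show ?thesis using that[of "max C 0"] by simp
qed

lemma vanishes_add:
  assumes "vanishes n a" "vanishes n b"
  shows "vanishes n (\<lambda>p. a p + b p)"
proof -
  obtain C D where "\<forall>\<^sub>F p in nhds 0. norm (a p) \<le> C * \<bar>snd p\<bar> ^ n"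
    "\<forall>\<^sub>F p in nhds 0. norm (b p) \<le> D * \<bar>snd p\<bar> ^ n"
    using assms by (auto simp: vanishes_def)
  then have "\<forall>\<^sub>F p in nhds 0. norm (a p + b p) \<le> (C + D) * \<bar>snd p\<bar> ^ n"
    by eventually_elim (simp add: distrib_right norm_triangle_mono)
  then show ?thesis by (auto simp: vanishes_def)
qed

lemma vanishes_scaleR:
  assumes "vanishes n a"
  shows "vanishes n (\<lambda>p. c *\<^sub>R a p)"
proof -
  obtain C where "\<forall>\<^sub>F p in nhds 0. norm (a p) \<le> C * \<bar>snd p\<bar> ^ n"
    using assms by (auto simp: vanishes_def)
  then have "\<forall>\<^sub>F p in nhds 0. norm (c *\<^sub>R a p) \<le> (\<bar>c\<bar> * C) * \<bar>snd p\<bar> ^ n"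
    by eventually_elim (simp add: mult.assoc mult_left_mono)
  then show ?thesis by (auto simp: vanishes_def)
qed

lemma vanishes_minus: "vanishes n a \<Longrightarrow> vanishes n (\<lambda>p. - a p)"
  by (simp add: vanishes_def)

lemma vanishes_diff: "vanishes n a \<Longrightarrow> vanishes n b \<Longrightarrow> vanishes n (\<lambda>p. a p - b p)"
  using vanishes_add[of n a "\<lambda>p. - b p"] vanishes_minus[of n b] by simp

lemma vanishes_power_scaleR:
  assumes "vanishes n a"
  shows "vanishes (n + j) (\<lambda>p. snd p ^ j *\<^sub>R a p)"
proof -
  obtain C where "\<forall>\<^sub>F p in nhds 0. norm (a p) \<le> C * \<bar>snd p\<bar> ^ n"
    using assms by (auto simp: vanishes_def)
  then have "\<forall>\<^sub>F p in nhds 0. norm (snd p ^ j *\<^sub>R a p) \<le> C * \<bar>snd p\<bar> ^ (n + j)"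
  proof eventually_elim
    case (elim p)
    then have "\<bar>snd p\<bar> ^ j * norm (a p) \<le> \<bar>snd p\<bar> ^ j * (C * \<bar>snd p\<bar> ^ n)"
      by (intro mult_left_mono) auto
    then show ?case by (simp add: power_add power_abs mult_ac)
  qed
  then show ?thesis by (auto simp: vanishes_def)
qed

lemma eventually_snd_le_1: "\<forall>\<^sub>F p in nhds (0::real \<times> real). \<bar>snd p\<bar> \<le> 1"
proof -
  have "\<bar>snd p\<bar> \<le> 1" if "dist p 0 < 1" for p :: "real \<times> real"
    using that norm_snd_le[of "snd p" "fst p"] by simp
  then show ?thesis unfolding eventually_nhds_metric by (intro exI[of _ 1]) auto
qed

lemma vanishes_mono:
  assumes "vanishes n a" "m \<le> n"
  shows "vanishes m a"
proof -
  obtain C where C: "C \<ge> 0" "\<forall>\<^sub>F p in nhds 0. norm (a p) \<le> C * \<bar>snd p\<bar> ^ n"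
    using assms vanishesE by metis
  from C(2) eventually_snd_le_1 have "\<forall>\<^sub>F p in nhds 0. norm (a p) \<le> C * \<bar>snd p\<bar> ^ m"
    by eventually_elim (erule order_trans, intro mult_left_mono power_decreasing assms(2) C(1), auto)
  then show ?thesis by (auto simp: vanishes_def)
qed

lemma vanishes_power_scaleR_le:
  "vanishes a u \<Longrightarrow> n \<le> a + j \<Longrightarrow> vanishes n (\<lambda>p. snd p ^ j *\<^sub>R u p)"
  using vanishes_power_scaleR vanishes_mono by blast

text \<open>Order 0 is just boundedness near the origin.\<close>

lemma vanishes_tendsto:
  assumes "(a \<longlongrightarrow> l) (nhds 0)"
  shows "vanishes 0 a"
proof -
  have "\<forall>\<^sub>F p in nhds 0. dist (a p) l < 1"
    using tendstoD[OF assms, of 1] by simp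
  then have "\<forall>\<^sub>F p in nhds 0. norm (a p) \<le> (norm l + 1) * \<bar>snd p\<bar> ^ 0"
  proof eventually_elim
    case (elim p)
    then show ?case using norm_triangle_sub[of "a p" l] by (simp add: dist_norm)
  qed
  then show ?thesis by (auto simp: vanishes_def)
qed

text \<open>The engine of every expansion below: the mean value inequality on the segment from (t,
  0) to (t, k) turns a bound on the derivative in \<open>k\<close> into a bound one order
  higher.\<close>

lemma vanishes_integrate:
  assumes der: "\<forall>\<^sub>F p in nhds 0. ((\<lambda>k. e (fst p, k)) has_vector_derivative e' p) (at (snd p))"
    and init: "\<forall>\<^sub>F t in nhds 0. e (t, 0) = 0"
    and e': "vanishes n e'"
  shows "vanishes (Suc n) e"
proof -
  obtain C where C: "C \<ge> 0" "\<forall>\<^sub>F p in nhds 0. norm (e' p) \<le> C * \<bar>snd p\<bar> ^ n"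
    using e' vanishesE by metis
  have "\<forall>\<^sub>F p::real \<times> real in nhds 0. e (fst p, 0) = 0"
    using tendsto_fst[OF filterlim_ident, of "0::real \<times> real"]
    by (intro eventually_compose_filterlim[OF init]) simp
  from eventually_conj[OF this eventually_conj[OF der C(2)]]
  obtain d where d: "d > 0" and *: "\<And>p. dist p 0 < d \<Longrightarrow> e (fst p, 0) = 0 \<and>
      ((\<lambda>k. e (fst p, k)) has_vector_derivative e' p) (at (snd p)) \<and> norm (e' p) \<le> C * \<bar>snd p\<bar> ^ n"
    unfolding eventually_nhds_metric by blast
  have "norm (e p) \<le> C * \<bar>snd p\<bar> ^ Suc n" if p: "dist p 0 < d" for p
  proof -
    obtain t k where tk: "p = (t, k)" by (cases p)
    \<comment> \<open>The product norm grows with the modulus of the second entry, so the whole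
      segment stays in the disc where the eventual facts hold.\<close>
    have near: "dist (t, s) 0 < d \<and> \<bar>s\<bar> \<le> \<bar>k\<bar>" if "s \<in> closed_segment 0 k" for s
    proof -
      have s: "\<bar>s\<bar> \<le> \<bar>k\<bar>" using that by (auto simp: closed_segment_eq_real_ivl split: if_splits)
      then have "s\<^sup>2 \<le> k\<^sup>2" by (rule abs_le_square_iff[THEN iffD1])
      then have "norm (t, s) \<le> norm (t, k)" by (simp add: norm_Pair)
      with p tk s show ?thesis by simp
    qed
    have bound: "norm (e (t, k) - e (t, 0)) \<le> C * \<bar>k\<bar> ^ n * norm (k - 0)"
    proof (rule norm_diff_le_vector_derivative[of "closed_segment 0 k" "\<lambda>s. e (t, s)" "\<lambda>s. e' (t, s)"])
      fix s assume s: "s \<in> closed_segment 0 k"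
      show "((\<lambda>s. e (t, s)) has_vector_derivative e' (t, s)) (at s within closed_segment 0 k)"
        using *[of "(t, s)"] near[OF s] by (auto intro: has_vector_derivative_at_within)
      show "norm (e' (t, s)) \<le> C * \<bar>k\<bar> ^ n"
        using *[of "(t, s)"] near[OF s] C(1)
        by (auto intro!: mult_left_mono power_mono elim: order_trans)
    qed auto
    moreover have "e (t, 0) = 0"
      using *[of p] p tk by simp
    ultimately show ?thesis
      by (simp add: tk mult_ac)
  qed
  then show ?thesis
    unfolding vanishes_def eventually_nhds_metric using d by blast
qed

lemma eventually_cball_0:
  assumes "vanishes 0 m"
  obtains R where "\<forall>\<^sub>F p in nhds 0. m p \<in> cball 0 R"
  using assms by (auto simp: vanishes_def)

text \<open>Orders of the arguments add: the base points stay in one ball, where the derivative is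
  bounded by a constant times the product of the norms of its arguments.\<close>

lemma vanishes_mderiv_map:
  fixes f :: "'a::euclidean_space \<Rightarrow> 'b::euclidean_space"
  assumes f: "smooth_on UNIV f" and m: "vanishes 0 m"
    and us: "list_all2 vanishes ns us"
  shows "vanishes (sum_list ns) (\<lambda>p. mderiv f (map (\<lambda>u. u p) us) (m p))"
proof -
  obtain R where R: "\<forall>\<^sub>F p in nhds 0. m p \<in> cball 0 R"
    using eventually_cball_0[OF m] .
  obtain B where B: "B \<ge> 0" "\<And>x vs. x \<in> cball 0 R \<Longrightarrow> length vs = length us \<Longrightarrow>
      norm (mderiv f vs x) \<le> B * prod_list (map norm vs)"
    using mderiv_bound[OF f, of 0 R "length us"] by blast
  have "\<exists>C\<ge>0. \<forall>\<^sub>F p in nhds 0. prod_list (map (\<lambda>u. norm (u p)) us) \<le> C * \<bar>snd p\<bar> ^ sum_list ns"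
    using us
  proof (induction ns us)
    case Nil
    show ?case by (rule exI[of _ 1]) simp
  next
    case (Cons n ns u us)
    then obtain C where C: "C \<ge> 0" "\<forall>\<^sub>F p in nhds 0. prod_list (map (\<lambda>u. norm (u p)) us) \<le> C * \<bar>snd p\<bar> ^ sum_list ns"
      by blast
    obtain D where D: "D \<ge> 0" "\<forall>\<^sub>F p in nhds 0. norm (u p) \<le> D * \<bar>snd p\<bar> ^ n"
      using Cons(1) vanishesE by metis
    have nn: "0 \<le> prod_list (map (\<lambda>u. norm (u p)) us)" for p
      by (induction us) auto
    have "\<forall>\<^sub>F p in nhds 0. norm (u p) * prod_list (map (\<lambda>u. norm (u p)) us)
        \<le> (D * \<bar>snd p\<bar> ^ n) * (C * \<bar>snd p\<bar> ^ sum_list ns)"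
      using C(2) D(2) by eventually_elim (intro mult_mono, auto simp: nn D(1))
    then show ?case
      using C(1) D(1) by (intro exI[of _ "D * C"]) (simp add: power_add mult_ac)
  qed
  then obtain C where C: "\<forall>\<^sub>F p in nhds 0. prod_list (map (\<lambda>u. norm (u p)) us) \<le> C * \<bar>snd p\<bar> ^ sum_list ns"
    by blast
  have "\<forall>\<^sub>F p in nhds 0. norm (mderiv f (map (\<lambda>u. u p) us) (m p)) \<le> (B * C) * \<bar>snd p\<bar> ^ sum_list ns"
    using R C
  proof eventually_elim
    case (elim p)
    have "norm (mderiv f (map (\<lambda>u. u p) us) (m p)) \<le> B * prod_list (map (\<lambda>u. norm (u p)) us)"
      using B(2)[OF elim(1), of "map (\<lambda>u. u p) us"] by (simp add: o_def)
    also have "\<dots> \<le> B * (C * \<bar>snd p\<bar> ^ sum_list ns)"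
      using elim(2) B(1) by (rule mult_left_mono)
    finally show ?case by (simp add: mult.assoc)
  qed
  then show ?thesis by (auto simp: vanishes_def)
qed

lemma vanishes_smooth:
  "smooth_on UNIV f \<Longrightarrow> vanishes 0 m \<Longrightarrow> vanishes 0 (\<lambda>p. f (m p))"
  using vanishes_mderiv_map[where us = "[]" and ns = "[]"] by simp

lemma vanishes_mderiv1:
  assumes "smooth_on UNIV f" "vanishes 0 m" "vanishes a u" "n \<le> a"
  shows "vanishes n (\<lambda>p. mderiv f [u p] (m p))"
  using vanishes_mderiv_map[where us = "[u]" and ns = "[a]", OF assms(1,2)] assms
  by (auto intro: vanishes_mono)

lemma vanishes_mderiv2:
  assumes "smooth_on UNIV f" "vanishes 0 m" "vanishes a u" "vanishes b v" "n \<le> a + b"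
  shows "vanishes n (\<lambda>p. mderiv f [u p, v p] (m p))"
  using vanishes_mderiv_map[where us = "[u, v]" and ns = "[a, b]", OF assms(1,2)] assms
  by (auto intro: vanishes_mono)

lemma vanishes_mderiv3:
  assumes "smooth_on UNIV f" "vanishes 0 m" "vanishes a u" "vanishes b v" "vanishes c w" "n \<le> a + b + c"
  shows "vanishes n (\<lambda>p. mderiv f [u p, v p, w p] (m p))"
  using vanishes_mderiv_map[where us = "[u, v, w]" and ns = "[a, b, c]", OF assms(1,2)] assms
  by (auto intro: vanishes_mono simp: add.assoc)

lemma vanishes_mderiv4:
  assumes "smooth_on UNIV f" "vanishes 0 m" "vanishes a u" "vanishes b v" "vanishes c w" "vanishes d z"
    and "n \<le> a + b + c + d"
  shows "vanishes n (\<lambda>p. mderiv f [u p, v p, w p, z p] (m p))"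
  using vanishes_mderiv_map[where us = "[u, v, w, z]" and ns = "[a, b, c, d]", OF assms(1,2)] assms
  by (auto intro: vanishes_mono simp: add.assoc)

lemma vanishes_locally_lipschitz:
  assumes "locally_lipschitz_at x0 g" "(a \<longlongrightarrow> x0) (nhds 0)" "(b \<longlongrightarrow> x0) (nhds 0)"
    and "vanishes n (\<lambda>p. a p - b p)"
  shows "vanishes n (\<lambda>p. g (a p) - g (b p))"
proof -
  obtain r L where r: "r > 0" "L-lipschitz_on (cball x0 r) g"
    using assms(1) by (auto simp: locally_lipschitz_at_def)
  obtain C where C: "\<forall>\<^sub>F p in nhds 0. norm (a p - b p) \<le> C * \<bar>snd p\<bar> ^ n"
    using assms(4) by (auto simp: vanishes_def)
  have "\<forall>\<^sub>F p in nhds 0. norm (g (a p) - g (b p)) \<le> (L * C) * \<bar>snd p\<bar> ^ n"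
    using C tendstoD[OF assms(2) r(1)] tendstoD[OF assms(3) r(1)]
  proof eventually_elim
    case (elim p)
    then have "norm (g (a p) - g (b p)) \<le> L * norm (a p - b p)"
      using lipschitz_on_normD[OF r(2), of "a p" "b p"] by (simp add: dist_commute)
    also have "\<dots> \<le> L * (C * \<bar>snd p\<bar> ^ n)"
      using elim lipschitz_on_nonneg[OF r(2)] by (intro mult_left_mono) auto
    finally show ?case by (simp add: mult.assoc)
  qed
  then show ?thesis by (auto simp: vanishes_def)
qed

lemma vanishes_taylor:
  fixes f :: "'a::euclidean_space \<Rightarrow> 'b::euclidean_space"
  assumes f: "smooth_on UNIV f" and m: "vanishes 0 m" and d: "vanishes 1 d"
  shows "vanishes n (\<lambda>p. f (m p + d p) - (\<Sum>j<n. (1 / fact j) *\<^sub>R mderiv f (replicate j (d p)) (m p)))"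
proof -
  obtain R1 where R1: "\<forall>\<^sub>F p in nhds 0. m p \<in> cball 0 R1"
    using eventually_cball_0[OF m] .
  have "vanishes 0 (\<lambda>p. m p + d p)"
    by (intro vanishes_add m vanishes_mono[OF d]) simp
  then obtain R2 where R2: "\<forall>\<^sub>F p in nhds 0. m p + d p \<in> cball 0 R2"
    by (rule eventually_cball_0)
  obtain B where B: "B \<ge> 0" "\<And>y v. y \<in> cball 0 (max R1 R2) \<Longrightarrow> y + v \<in> cball 0 (max R1 R2) \<Longrightarrow>
      norm (f (y + v) - (\<Sum>j<n. (1 / fact j) *\<^sub>R mderiv f (replicate j v) y)) \<le> B * norm v ^ n"
    using taylor_mderiv[OF f, of 0 "max R1 R2" n] by blast
  obtain C where C: "C \<ge> 0" "\<forall>\<^sub>F p in nhds 0. norm (d p) \<le> C * \<bar>snd p\<bar> ^ 1"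
    using d vanishesE by metis
  have "\<forall>\<^sub>F p in nhds 0. norm (f (m p + d p) - (\<Sum>j<n. (1 / fact j) *\<^sub>R mderiv f (replicate j (d p)) (m p)))
      \<le> (B * C ^ n) * \<bar>snd p\<bar> ^ n"
    using R1 R2 C(2)
  proof eventually_elim
    case (elim p)
    have "norm (f (m p + d p) - (\<Sum>j<n. (1 / fact j) *\<^sub>R mderiv f (replicate j (d p)) (m p))) \<le> B * norm (d p) ^ n"
      using elim by (intro B(2)) auto
    also have "\<dots> \<le> B * (C * \<bar>snd p\<bar>) ^ n"
      using elim B(1) by (intro mult_left_mono power_mono) auto
    finally show ?case by (simp add: power_mult_distrib mult.assoc)
  qed
  then show ?thesis by (auto simp: vanishes_def)
qed

section \<open>Elementary differentials and the average of the field over a chord\<close>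

text \<open>The value is 1/(j+1) for even \<open>j\<close> and 0 for odd \<open>j\<close>. On a
  chord centred at its midpoint this removes the odd Taylor terms and yields the weights 1/(2! 3) =
  1/6 and 1/(4! 5) = 1/120.\<close>

lemma has_integral_centered_power:
  "((\<lambda>\<xi>. (2 * \<xi> - 1) ^ j) has_integral (1 - (- 1) ^ Suc j) / (2 * real (Suc j))) {0..1::real}"
proof -
  let ?F = "\<lambda>\<xi>::real. (2 * \<xi> - 1) ^ Suc j / (2 * real (Suc j))"
  have "((\<lambda>\<xi>. (2 * \<xi> - 1) ^ j) has_integral ?F 1 - ?F 0) {0..1}"
  proof (rule fundamental_theorem_of_calculus)
    fix \<xi> :: real assume "\<xi> \<in> {0..1}"
    have "((\<lambda>\<xi>. (2 * \<xi> - 1) ^ Suc j) has_real_derivative real (Suc j) * (2 * \<xi> - 1) ^ j * 2) (at \<xi> within {0..1})"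
      by (auto intro!: derivative_eq_intros simp del: power_Suc)
    from DERIV_cdivide[OF this, of "2 * real (Suc j)"]
    show "(?F has_vector_derivative (2 * \<xi> - 1) ^ j) (at \<xi> within {0..1})"
      by (simp add: has_real_derivative_iff_has_vector_derivative del: of_nat_Suc power_Suc)
  qed simp
  then show ?thesis by (simp add: add_divide_distrib)
qed

locale smooth_field =
  fixes f :: "'a::euclidean_space \<Rightarrow> 'a"
  assumes smooth: "smooth_on UNIV f"
begin

abbreviation D :: "'a list \<Rightarrow> 'a \<Rightarrow> 'a" where
  "D \<equiv> mderiv f"

text \<open>Linearity in the first four slots suffices, since the explicit terms go up to the fourth
  derivative.\<close>

lemmas mderiv_linear =
  linear_add[OF linear_mderiv[OF smooth, where us = "[]"], simplified]
  linear_add[OF linear_mderiv[OF smooth, where us = "[u]" for u], simplified]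
  linear_add[OF linear_mderiv[OF smooth, where us = "[u, v]" for u v], simplified]
  linear_add[OF linear_mderiv[OF smooth, where us = "[u, v, w]" for u v w], simplified]
  linear_diff[OF linear_mderiv[OF smooth, where us = "[]"], simplified]
  linear_diff[OF linear_mderiv[OF smooth, where us = "[u]" for u], simplified]
  linear_diff[OF linear_mderiv[OF smooth, where us = "[u, v]" for u v], simplified]
  linear_diff[OF linear_mderiv[OF smooth, where us = "[u, v, w]" for u v w], simplified]
  linear_scale[OF linear_mderiv[OF smooth, where us = "[]"], simplified]
  linear_scale[OF linear_mderiv[OF smooth, where us = "[u]" for u], simplified]
  linear_scale[OF linear_mderiv[OF smooth, where us = "[u, v]" for u v], simplified]
  linear_scale[OF linear_mderiv[OF smooth, where us = "[u, v, w]" for u v w], simplified]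
  linear_neg[OF linear_mderiv[OF smooth, where us = "[]"], simplified]
  linear_neg[OF linear_mderiv[OF smooth, where us = "[u]" for u], simplified]
  linear_neg[OF linear_mderiv[OF smooth, where us = "[u, v]" for u v], simplified]
  linear_neg[OF linear_mderiv[OF smooth, where us = "[u, v, w]" for u v w], simplified]

text \<open>The k^2 terms of 2 d' = f(m + d) + f(m - d) give 3 c_3 = (1/2) f''(f,f) - f'f'f: the
  first part is f''(d,d)/2 at d = k f, the second comes from differentiating k f(m), where m' = k
  f'f to leading order.\<close>

definition coeff3 :: "'a \<Rightarrow> 'a" where
  "coeff3 x = (1/6) *\<^sub>R D [f x, f x] x - (1/3) *\<^sub>R D [D [f x] x] x"

text \<open>The derivative of \<open>coeff3\<close> at \<open>x\<close> in direction
  \<open>v\<close>, see \<open>has_vector_derivative_coeff3\<close>. Writing out the product rule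
  makes the order conditions a linear identity between elementary differentials.\<close>

definition coeff3_deriv :: "'a \<Rightarrow> 'a \<Rightarrow> 'a" where
  "coeff3_deriv x v = (1/6) *\<^sub>R (D [v, f x, f x] x + D [D [v] x, f x] x + D [f x, D [v] x] x)
     - (1/3) *\<^sub>R (D [v, D [f x] x] x + D [D [v, f x] x + D [D [v] x] x] x)"

text \<open>Determined by the terms of order \<open>k\<^sup>4\<close> in \<open>2 d' = f(m + d) + f(m - d)\<close>, where \<open>m' = k f'f + O(k\<^sup>3)\<close>.\<close>

definition coeff5 :: "'a \<Rightarrow> 'a" where
  "coeff5 x = (1/5) *\<^sub>R (D [f x, coeff3 x] x + (1/24) *\<^sub>R D [f x, f x, f x, f x] x
     - D [D [coeff3 x] x] x - (1/6) *\<^sub>R D [D [f x, f x, f x] x] x - coeff3_deriv x (D [f x] x))"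

text \<open>The bracket \<open>6 A\<^sub>1 - A\<^sub>2 + A\<^sub>3 - A\<^sub>4 - 3/2 A\<^sub>5 - 3/2 A\<^sub>6 + 3 A\<^sub>7 + 3 A\<^sub>8\<close> of the method, applied to \<open>w\<close>.\<close>

definition avf5 :: "'a \<Rightarrow> 'a \<Rightarrow> 'a" where
  "avf5 x w = 6 *\<^sub>R D [D [D [D [w] x] x] x] x - D [D [w, f x] x, f x] x
     + D [D [D [w, f x] x] x] x - D [D [D [w] x] x, f x] x
     - (3/2) *\<^sub>R D [D [w, f x, f x] x] x - (3/2) *\<^sub>R D [D [w] x, f x, f x] x
     + 3 *\<^sub>R D [D [w] x, D [f x] x] x + 3 *\<^sub>R D [D [w, D [f x] x] x] x"

lemma has_vector_derivative_coeff3: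
  assumes X: "(X has_vector_derivative X') (at k within S)"
  shows "((\<lambda>k. coeff3 (X k)) has_vector_derivative coeff3_deriv (X k) X') (at k within S)"
proof -
  have F: "((\<lambda>k. f (X k)) has_vector_derivative D [X'] (X k)) (at k within S)"
    using has_vector_derivative_mderiv[OF smooth X, of "[]"] by simp
  have A: "((\<lambda>k. D [f (X k)] (X k)) has_vector_derivative D [X', f (X k)] (X k) + D [D [X'] (X k)] (X k)) (at k within S)"
    by (rule has_vector_derivative_mderiv1[OF smooth X F])
  show ?thesis
    unfolding coeff3_def coeff3_deriv_def
    by (intro has_vector_derivative_diff has_vector_derivative_scaleR_const has_vector_derivative_mderiv2[OF smooth X F F]
        has_vector_derivative_mderiv1[OF smooth X A])
qed

text \<open>The order conditions of order five; symmetry of \<open>f''\<close> is needed here.\<close>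

lemma coeff5_eq_avf5:
  "coeff5 x = (1/3) *\<^sub>R D [f x, coeff3 x] x + (1/120) *\<^sub>R D [f x, f x, f x, f x] x
     - (1/18) *\<^sub>R D [D [D [f x, f x] x] x] x + (1/45) *\<^sub>R avf5 x (f x)"
proof -
  let ?f = "f x"
  have s1: "D [?f, D vs x] x = D [D vs x, ?f] x" for vs
    by (rule mderiv_swap2[OF smooth])
  show ?thesis
    \<comment> \<open>After slotwise linearity and the swap \<open>s1\<close>, pairing with a basis
      vector leaves a linear identity between real numbers.\<close>
    by (rule euclidean_eqI)
      (simp only: coeff5_def coeff3_def coeff3_deriv_def avf5_def s1 mderiv_linear inner_simps, simp only: ring_distribs)
qed

lemma locally_lipschitz_at_coeff3: "locally_lipschitz_at x0 coeff3"
  unfolding coeff3_def[abs_def]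
  by (intro locally_lipschitz_at_diff locally_lipschitz_at_scale locally_lipschitz_at_mderiv[OF smooth]
      locally_lipschitz_at_ident)

lemma locally_lipschitz_at_coeff5: "locally_lipschitz_at x0 coeff5"
  unfolding coeff5_def[abs_def] coeff3_deriv_def[abs_def]
  by (intro locally_lipschitz_at_diff locally_lipschitz_at_add locally_lipschitz_at_scale locally_lipschitz_at_mderiv[OF smooth]
      locally_lipschitz_at_ident locally_lipschitz_at_coeff3)

lemma locally_lipschitz_at_avf5:
  "locally_lipschitz_at x0 m \<Longrightarrow> locally_lipschitz_at x0 w \<Longrightarrow> locally_lipschitz_at x0 (\<lambda>x. avf5 (m x) (w x))"
  unfolding avf5_def
  by (intro locally_lipschitz_at_diff locally_lipschitz_at_add locally_lipschitz_at_scale locally_lipschitz_at_mderiv[OF smooth]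
     )

lemma vanishes_avf5:
  assumes m: "vanishes 0 m" and w: "vanishes n w"
  shows "vanishes n (\<lambda>p. avf5 (m p) (w p))"
proof -
  note D1 = vanishes_mderiv1[OF smooth m _ order_refl]
  have D2: "vanishes n (\<lambda>p. D [u p, v p] (m p))" if "vanishes n u" "vanishes 0 v" for u v
    by (rule vanishes_mderiv2[OF smooth m that]) simp
  have D3: "vanishes n (\<lambda>p. D [u p, v p, v p] (m p))" if "vanishes n u" "vanishes 0 v" for u v
    by (rule vanishes_mderiv3[OF smooth m that(1,2,2)]) simp
  show ?thesis
    unfolding avf5_def
    by (intro vanishes_diff vanishes_add vanishes_scaleR D2 D3 D1 w vanishes_smooth[OF smooth m])
qed

lemma vanishes_coeff3_deriv:
  assumes m: "vanishes 0 m" and w: "vanishes n w"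
  shows "vanishes n (\<lambda>p. coeff3_deriv (m p) (w p))"
proof -
  note D1 = vanishes_mderiv1[OF smooth m _ order_refl]
  have D2: "vanishes n (\<lambda>p. D [u p, v p] (m p))" if "vanishes n u" "vanishes 0 v" for u v
    by (rule vanishes_mderiv2[OF smooth m that]) simp
  have D2': "vanishes n (\<lambda>p. D [v p, u p] (m p))" if "vanishes n u" "vanishes 0 v" for u v
    by (rule vanishes_mderiv2[OF smooth m that(2,1)]) simp
  have D3: "vanishes n (\<lambda>p. D [u p, v p, v p] (m p))" if "vanishes n u" "vanishes 0 v" for u v
    by (rule vanishes_mderiv3[OF smooth m that(1,2,2)]) simp
  have F: "vanishes 0 (\<lambda>p. f (m p))" by (rule vanishes_smooth[OF smooth m])
  show ?thesis
    unfolding coeff3_deriv_def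
    by (intro vanishes_diff vanishes_add vanishes_scaleR D1[OF w] D1 D2[OF w] D3[OF w] D2[OF D1[OF w]]
        D2'[OF D1[OF w]] F)
qed

lemma coeff3_deriv_linear: "coeff3_deriv x (v + w) = coeff3_deriv x v + coeff3_deriv x w" "coeff3_deriv x (c *\<^sub>R v) = c *\<^sub>R coeff3_deriv x v"
  by (simp_all add: coeff3_deriv_def mderiv_linear algebra_simps)

lemma avf5_linear: "avf5 x (v + w) = avf5 x v + avf5 x w"
  by (simp add: avf5_def mderiv_linear algebra_simps)

lemma vanishes_coeff3:
  assumes m: "vanishes 0 m"
  shows "vanishes 0 (\<lambda>p. coeff3 (m p))"
proof -
  have F: "vanishes 0 (\<lambda>p. f (m p))" by (rule vanishes_smooth[OF smooth m])
  show ?thesis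
    unfolding coeff3_def
    by (intro vanishes_diff vanishes_scaleR vanishes_mderiv2[OF smooth m F F] order.refl
        vanishes_mderiv1[OF smooth m vanishes_mderiv1[OF smooth m F]]) simp_all
qed

text \<open>The prefix \<open>us\<close> collects the slots already freed of the scalar, which lets
  the induction move along the list.\<close>

lemma mderiv_replicate_scale:
  "mderiv f (us @ replicate j (c *\<^sub>R d)) x = c ^ j *\<^sub>R mderiv f (us @ replicate j d) x"
proof (induction j arbitrary: us)
  case 0
  then show ?case by simp
next
  case (Suc j)
  have "mderiv f (us @ replicate (Suc j) (c *\<^sub>R d)) x = c *\<^sub>R mderiv f ((us @ [d]) @ replicate j (c *\<^sub>R d)) x"
    using linear_scale[OF linear_mderiv[OF smooth, of us "replicate j (c *\<^sub>R d)" x]] by simp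
  also have "\<dots> = c ^ Suc j *\<^sub>R mderiv f (us @ replicate (Suc j) d) x"
    unfolding Suc.IH by simp
  finally show ?case .
qed

text \<open>On the chord the argument of \<open>f\<close> is m + (2\<xi> - 1) d. The Taylor
  polynomial includes j = 5, which integrates to 0, so the error has order 6 although the last
  visible term is the fourth.\<close>

lemma vanishes_segment_average:
  assumes m: "vanishes 0 m" and d: "vanishes 1 d"
  shows "vanishes 6 (\<lambda>p. integral {0..1} (\<lambda>\<xi>. f (\<xi> *\<^sub>R (m p + d p) + (1 - \<xi>) *\<^sub>R (m p - d p)))
      - (f (m p) + (1/6) *\<^sub>R D [d p, d p] (m p) + (1/120) *\<^sub>R D [d p, d p, d p, d p] (m p)))"
proof -
  have md: "vanishes 0 (\<lambda>p. m p + d p)" "vanishes 0 (\<lambda>p. m p - d p)"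
    using m vanishes_mono[OF d, of 0] by (auto intro: vanishes_add vanishes_diff)
  obtain R1 where R1: "\<forall>\<^sub>F p in nhds 0. m p + d p \<in> cball 0 R1"
    using eventually_cball_0[OF md(1)] .
  obtain R2 where R2: "\<forall>\<^sub>F p in nhds 0. m p - d p \<in> cball 0 R2"
    using eventually_cball_0[OF md(2)] .
  let ?R = "max R1 R2"
  obtain B where B: "B \<ge> 0" "\<And>y v. y \<in> cball 0 ?R \<Longrightarrow> y + v \<in> cball 0 ?R \<Longrightarrow>
      norm (f (y + v) - (\<Sum>j<6. (1 / fact j) *\<^sub>R mderiv f (replicate j v) y)) \<le> B * norm v ^ 6"
    using taylor_mderiv[OF smooth, of 0 ?R 6] by blast
  obtain C where C: "C \<ge> 0" "\<forall>\<^sub>F p in nhds 0. norm (d p) \<le> C * \<bar>snd p\<bar> ^ 1"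
    using d vanishesE by metis
  have "\<forall>\<^sub>F p in nhds 0. norm (integral {0..1} (\<lambda>\<xi>. f (\<xi> *\<^sub>R (m p + d p) + (1 - \<xi>) *\<^sub>R (m p - d p)))
      - (f (m p) + (1/6) *\<^sub>R D [d p, d p] (m p) + (1/120) *\<^sub>R D [d p, d p, d p, d p] (m p)))
      \<le> (B * C ^ 6) * \<bar>snd p\<bar> ^ 6"
    using R1 R2 C(2)
  proof eventually_elim
    case (elim p)
    let ?m = "m p" and ?d = "d p"
    let ?g = "\<lambda>\<xi>. f (\<xi> *\<^sub>R (?m + ?d) + (1 - \<xi>) *\<^sub>R (?m - ?d))"
    let ?P = "\<lambda>\<xi>. \<Sum>j<6. ((2 * \<xi> - 1) ^ j) *\<^sub>R ((1 / fact j) *\<^sub>R D (replicate j ?d) ?m)"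
    have ends: "?m + ?d \<in> cball 0 ?R" "?m - ?d \<in> cball 0 ?R"
      using elim by auto
    have seg: "\<xi> *\<^sub>R (?m + ?d) + (1 - \<xi>) *\<^sub>R (?m - ?d) = ?m + (2 * \<xi> - 1) *\<^sub>R ?d" for \<xi>
      by (rule euclidean_eqI) (simp add: inner_simps algebra_simps)
    have inball: "?m + (2 * \<xi> - 1) *\<^sub>R ?d \<in> cball 0 ?R" if "\<xi> \<in> {0..1}" for \<xi>
      unfolding seg[symmetric] using that ends by (intro convexD convex_cball) auto
    have mid: "?m \<in> cball 0 ?R"
      using inball[of "1/2"] by simp
    have P: "(?P has_integral (\<Sum>j<6. ((1 - (- 1) ^ Suc j) / (2 * real (Suc j))) *\<^sub>R ((1 / fact j) *\<^sub>R D (replicate j ?d) ?m))) {0..1}"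
      by (intro has_integral_sum has_integral_scaleR_left has_integral_centered_power) auto
    moreover have "continuous_on {0..1} ?g"
      by (intro continuous_on_compose2[OF continuous_on_mderiv[OF smooth, of UNIV "[]", unfolded mderiv.simps(1)[abs_def]]]
          continuous_intros) auto
    then have "(?g has_integral integral {0..1} ?g) {0..1}"
      by (intro integrable_integral integrable_continuous_real)
    ultimately have I: "((\<lambda>\<xi>. ?g \<xi> - ?P \<xi>) has_integral (integral {0..1} ?g
        - (\<Sum>j<6. ((1 - (- 1) ^ Suc j) / (2 * real (Suc j))) *\<^sub>R ((1 / fact j) *\<^sub>R D (replicate j ?d) ?m)))) {0..1}"
      by (intro has_integral_diff)
    have "norm (?g \<xi> - ?P \<xi>) \<le> B * norm ?d ^ 6" if \<xi>: "\<xi> \<in> {0..1}" for \<xi>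
    proof -
      have "norm (?g \<xi> - ?P \<xi>) \<le> B * norm ((2 * \<xi> - 1) *\<^sub>R ?d) ^ 6"
        using B(2)[OF mid inball[OF \<xi>]] mderiv_replicate_scale[of "[]" _ "2 * \<xi> - 1" ?d ?m]
        by (simp add: seg mult.commute)
      also have "\<dots> \<le> B * norm ?d ^ 6"
        using \<xi> B(1) by (intro mult_left_mono power_mono) (auto intro!: mult_left_le_one_le)
      finally show ?thesis .
    qed
    with B(1) have "norm (integral {0..1} ?g
        - (\<Sum>j<6. ((1 - (- 1) ^ Suc j) / (2 * real (Suc j))) *\<^sub>R ((1 / fact j) *\<^sub>R D (replicate j ?d) ?m)))
        \<le> B * norm ?d ^ 6 * Henstock_Kurzweil_Integration.content {0..1::real}"
      by (intro has_integral_bound_real[OF _ finite.emptyI I]) auto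
    also have "(\<Sum>j<6. ((1 - (- 1) ^ Suc j) / (2 * real (Suc j))) *\<^sub>R ((1 / fact j) *\<^sub>R D (replicate j ?d) ?m))
        = f ?m + (1/6) *\<^sub>R D [?d, ?d] ?m + (1/120) *\<^sub>R D [?d, ?d, ?d, ?d] ?m"
      by (simp add: eval_nat_numeral)
    also have "B * norm ?d ^ 6 * Henstock_Kurzweil_Integration.content {0..1::real} \<le> B * (C * \<bar>snd p\<bar>) ^ 6"
      using elim B(1) by (auto intro!: mult_left_mono power_mono)
    finally show ?case by (simp add: power_mult_distrib mult.assoc)
  qed
  then show ?thesis by (auto simp: vanishes_def)
qed

end

section \<open>The chord of an exact solution\<close>

locale field_solution = smooth_field f for f :: "'a::euclidean_space \<Rightarrow> 'a" +
  fixes \<phi> :: "real \<Rightarrow> 'a"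
  assumes solution: "\<exists>\<epsilon>>0. \<forall>t\<in>{-\<epsilon><..<\<epsilon>}. (\<phi> has_vector_derivative f (\<phi> t)) (at t)"
begin

definition mid :: "real \<times> real \<Rightarrow> 'a" where
  "mid p = (1/2) *\<^sub>R (\<phi> (fst p + snd p) + \<phi> (fst p - snd p))"

definition half_chord :: "real \<times> real \<Rightarrow> 'a" where
  "half_chord p = (1/2) *\<^sub>R (\<phi> (fst p + snd p) - \<phi> (fst p - snd p))"

text \<open>The derivative of \<open>mid\<close> in \<open>k\<close>, written through
  \<open>mid\<close> and \<open>half_chord\<close> alone by means of the differential equation;
  \<open>half_chord'\<close> likewise. This closes the system.\<close>

definition mid' :: "real \<times> real \<Rightarrow> 'a" where
  "mid' p = (1/2) *\<^sub>R (f (mid p + half_chord p) - f (mid p - half_chord p))"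

definition half_chord' :: "real \<times> real \<Rightarrow> 'a" where
  "half_chord' p = (1/2) *\<^sub>R (f (mid p + half_chord p) + f (mid p - half_chord p))"

lemma mid_plus_half: "mid p + half_chord p = \<phi> (fst p + snd p)" "mid p - half_chord p = \<phi> (fst p - snd p)"
  unfolding mid_def half_chord_def scaleR_add_right[symmetric] scaleR_diff_right[symmetric] by simp_all

lemma eventually_solution: "\<forall>\<^sub>F t in nhds 0. (\<phi> has_vector_derivative f (\<phi> t)) (at t)"
proof -
  obtain \<epsilon> where \<epsilon>: "\<epsilon> > 0" "\<And>t. t \<in> {-\<epsilon><..<\<epsilon>} \<Longrightarrow> (\<phi> has_vector_derivative f (\<phi> t)) (at t)"
    using solution by blast
  have "\<forall>\<^sub>F t in nhds 0. t \<in> {-\<epsilon><..<\<epsilon>}"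
    by (rule eventually_nhds_in_open) (use \<epsilon>(1) in auto)
  then show ?thesis
    by eventually_elim (rule \<epsilon>(2))
qed

lemma tendsto_fst_snd:
  "(fst \<longlongrightarrow> 0) (nhds (0::real \<times> real))" "(snd \<longlongrightarrow> 0) (nhds (0::real \<times> real))"
  using tendsto_fst[OF filterlim_ident, of "0::real \<times> real"] tendsto_snd[OF filterlim_ident, of "0::real \<times> real"]
  by simp_all

lemma tendsto_plus_minus:
  "((\<lambda>p. fst p + snd p) \<longlongrightarrow> 0) (nhds (0::real \<times> real))"
  "((\<lambda>p. fst p - snd p) \<longlongrightarrow> 0) (nhds (0::real \<times> real))"
  using tendsto_add[OF tendsto_fst_snd] tendsto_diff[OF tendsto_fst_snd] by simp_all

lemma tendsto_solution: "(\<phi> \<longlongrightarrow> \<phi> 0) (nhds 0)"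
proof -
  have "(\<phi> has_vector_derivative f (\<phi> 0)) (at 0)"
    using eventually_solution by (rule eventually_nhds_x_imp_x)
  then show ?thesis
    by (simp add: has_vector_derivative_continuous isCont_def[symmetric] tendsto_at_iff_tendsto_nhds[symmetric])
qed

lemma tendsto_mid: "(mid \<longlongrightarrow> \<phi> 0) (nhds 0)"
proof -
  have "((\<lambda>p. (1/2) *\<^sub>R (\<phi> (fst p + snd p) + \<phi> (fst p - snd p))) \<longlongrightarrow> (1/2) *\<^sub>R (\<phi> 0 + \<phi> 0)) (nhds 0)"
    by (intro tendsto_intros filterlim_compose[OF tendsto_solution] tendsto_plus_minus)
  then show ?thesis
    by (simp add: mid_def[abs_def] scaleR_2[symmetric])
qed

lemma tendsto_half: "(half_chord \<longlongrightarrow> 0) (nhds 0)"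
proof -
  have "((\<lambda>p. (1/2) *\<^sub>R (\<phi> (fst p + snd p) - \<phi> (fst p - snd p))) \<longlongrightarrow> (1/2) *\<^sub>R (\<phi> 0 - \<phi> 0)) (nhds 0)"
    by (intro tendsto_intros filterlim_compose[OF tendsto_solution] tendsto_plus_minus)
  then show ?thesis
    by (simp add: half_chord_def[abs_def])
qed

lemma tendsto_center: "((\<lambda>p. \<phi> (fst p)) \<longlongrightarrow> \<phi> 0) (nhds (0::real \<times> real))"
  by (intro filterlim_compose[OF tendsto_solution] tendsto_fst_snd)

lemma eventually_solution_plus_minus:
  "\<forall>\<^sub>F p in nhds 0. ((\<lambda>k. \<phi> (fst p + k)) has_vector_derivative f (\<phi> (fst p + snd p))) (at (snd p))"
  "\<forall>\<^sub>F p in nhds 0. ((\<lambda>k. \<phi> (fst p - k)) has_vector_derivative - f (\<phi> (fst p - snd p))) (at (snd p))"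
proof -
  show "\<forall>\<^sub>F p in nhds 0. ((\<lambda>k. \<phi> (fst p + k)) has_vector_derivative f (\<phi> (fst p + snd p))) (at (snd p))"
    using eventually_compose_filterlim[OF eventually_solution tendsto_plus_minus(1)]
  proof eventually_elim
    case (elim p)
    have "((\<lambda>k. fst p + k) has_vector_derivative 1) (at (snd p))"
      by (auto intro!: derivative_eq_intros)
    from vector_diff_chain_at[OF this elim] show ?case by (simp add: o_def)
  qed
  show "\<forall>\<^sub>F p in nhds 0. ((\<lambda>k. \<phi> (fst p - k)) has_vector_derivative - f (\<phi> (fst p - snd p))) (at (snd p))"
    using eventually_compose_filterlim[OF eventually_solution tendsto_plus_minus(2)]
  proof eventually_elim
    case (elim p)
    have "((\<lambda>k. fst p - k) has_vector_derivative - 1) (at (snd p))"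
      by (auto intro!: derivative_eq_intros)
    from vector_diff_chain_at[OF this elim] show ?case by (simp add: o_def)
  qed
qed

lemma eventually_mid_deriv:
  "\<forall>\<^sub>F p in nhds 0. ((\<lambda>k. mid (fst p, k)) has_vector_derivative mid' p) (at (snd p))"
  using eventually_solution_plus_minus
proof eventually_elim
  case (elim p)
  from has_vector_derivative_scaleR_const[OF has_vector_derivative_add[OF elim], of "1/2"]
  show ?case unfolding mid'_def mid_plus_half by (simp add: mid_def)
qed

lemma eventually_half_deriv:
  "\<forall>\<^sub>F p in nhds 0. ((\<lambda>k. half_chord (fst p, k)) has_vector_derivative half_chord' p) (at (snd p))"
  using eventually_solution_plus_minus
proof eventually_elim
  case (elim p)
  from has_vector_derivative_scaleR_const[OF has_vector_derivative_diff[OF elim], of "1/2"]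
  show ?case unfolding half_chord'_def mid_plus_half by (simp add: half_chord_def)
qed

lemma mid_0: "mid (t, 0) = \<phi> t" and half_chord_0: "half_chord (t, 0) = 0"
  by (simp_all add: mid_def half_chord_def scaleR_2[symmetric])

lemma vanishes_mid: "vanishes 0 mid"
  by (rule vanishes_tendsto[OF tendsto_mid])

lemma vanishes_f_mid: "vanishes 0 (\<lambda>p. f (mid p))"
  by (rule vanishes_smooth[OF smooth vanishes_mid])

text \<open>Bootstrap: continuity bounds \<open>half_chord\<close>, hence
  \<open>half_chord'\<close>, and integrating from \<open>half_chord (t, 0) = 0\<close> gains the
  order.\<close>

lemma vanishes_half: "vanishes 1 half_chord"
proof -
  have h0: "vanishes 0 half_chord" by (rule vanishes_tendsto[OF tendsto_half])
  have "vanishes 0 half_chord'"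
    unfolding half_chord'_def
    by (intro vanishes_scaleR vanishes_add vanishes_smooth[OF smooth] vanishes_diff vanishes_mid h0)
  from vanishes_integrate[OF eventually_half_deriv _ this] show ?thesis
    by (simp add: half_chord_0)
qed

lemma vanishes_taylor_plus_minus:
  "vanishes n (\<lambda>p. f (mid p + half_chord p) - (\<Sum>j<n. (1 / fact j) *\<^sub>R D (replicate j (half_chord p)) (mid p)))"
  "vanishes n (\<lambda>p. f (mid p - half_chord p) - (\<Sum>j<n. ((-1) ^ j / fact j) *\<^sub>R D (replicate j (half_chord p)) (mid p)))"
proof -
  show "vanishes n (\<lambda>p. f (mid p + half_chord p) - (\<Sum>j<n. (1 / fact j) *\<^sub>R D (replicate j (half_chord p)) (mid p)))"
    by (rule vanishes_taylor[OF smooth vanishes_mid vanishes_half])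
  have "D (replicate j (- half_chord p)) (mid p) = (-1) ^ j *\<^sub>R D (replicate j (half_chord p)) (mid p)" for j p
    using mderiv_replicate_scale[of "[]" j "-1"] by simp
  then show "vanishes n (\<lambda>p. f (mid p - half_chord p) - (\<Sum>j<n. ((-1) ^ j / fact j) *\<^sub>R D (replicate j (half_chord p)) (mid p)))"
    using vanishes_taylor[OF smooth vanishes_mid vanishes_minus[OF vanishes_half], of n]
    by simp
qed

text \<open>The weight is 0 for odd \<open>j\<close>, so for even \<open>n\<close> the last
  surviving term is j = n - 2 while the error keeps order \<open>n\<close>. Hence the orders 2, 4, 6
  used below, and 1, 3, 5 for \<open>mid'\<close>, where the even terms cancel.\<close>

lemma vanishes_half'_taylor:
  "vanishes n (\<lambda>p. half_chord' p - (\<Sum>j<n. ((1 + (-1) ^ j) / (2 * fact j)) *\<^sub>R D (replicate j (half_chord p)) (mid p)))"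
proof -
  have "(\<Sum>j<n. ((1 + (-1) ^ j) / (2 * fact j)) *\<^sub>R X j)
      = (1/2) *\<^sub>R ((\<Sum>j<n. (1 / fact j) *\<^sub>R X j) + (\<Sum>j<n. ((-1) ^ j / fact j) *\<^sub>R X j))" for X :: "nat \<Rightarrow> 'a"
    unfolding sum.distrib[symmetric] scaleR_sum_right
    by (intro sum.cong refl) (simp add: scaleR_add_left[symmetric] add_divide_distrib[symmetric])
  then have "(\<lambda>p. half_chord' p - (\<Sum>j<n. ((1 + (-1) ^ j) / (2 * fact j)) *\<^sub>R D (replicate j (half_chord p)) (mid p)))
      = (\<lambda>p. (1/2) *\<^sub>R ((f (mid p + half_chord p) - (\<Sum>j<n. (1 / fact j) *\<^sub>R D (replicate j (half_chord p)) (mid p)))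
        + (f (mid p - half_chord p) - (\<Sum>j<n. ((-1) ^ j / fact j) *\<^sub>R D (replicate j (half_chord p)) (mid p)))))"
    unfolding half_chord'_def by (simp only: scaleR_add_right scaleR_diff_right diff_diff_eq2 diff_diff_eq add_diff_eq diff_add_eq ac_simps)
  then show ?thesis
    by (simp only:) (intro vanishes_scaleR vanishes_add vanishes_taylor_plus_minus)
qed

lemma vanishes_mid'_taylor:
  "vanishes n (\<lambda>p. mid' p - (\<Sum>j<n. ((1 - (-1) ^ j) / (2 * fact j)) *\<^sub>R D (replicate j (half_chord p)) (mid p)))"
proof -
  have "(\<Sum>j<n. ((1 - (-1) ^ j) / (2 * fact j)) *\<^sub>R X j)
      = (1/2) *\<^sub>R ((\<Sum>j<n. (1 / fact j) *\<^sub>R X j) - (\<Sum>j<n. ((-1) ^ j / fact j) *\<^sub>R X j))" for X :: "nat \<Rightarrow> 'a"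
    unfolding sum_subtractf[symmetric] scaleR_sum_right
    by (intro sum.cong refl) (simp add: scaleR_diff_left[symmetric] diff_divide_distrib[symmetric])
  then have "(\<lambda>p. mid' p - (\<Sum>j<n. ((1 - (-1) ^ j) / (2 * fact j)) *\<^sub>R D (replicate j (half_chord p)) (mid p)))
      = (\<lambda>p. (1/2) *\<^sub>R ((f (mid p + half_chord p) - (\<Sum>j<n. (1 / fact j) *\<^sub>R D (replicate j (half_chord p)) (mid p)))
        - (f (mid p - half_chord p) - (\<Sum>j<n. ((-1) ^ j / fact j) *\<^sub>R D (replicate j (half_chord p)) (mid p)))))"
    unfolding mid'_def by (simp only: scaleR_add_right scaleR_diff_right diff_diff_eq2 diff_diff_eq add_diff_eq diff_add_eq ac_simps)
  then show ?thesis
    by (simp only:) (intro vanishes_scaleR vanishes_diff vanishes_taylor_plus_minus)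
qed

lemma vanishes_half'_expansions:
  "vanishes 2 (\<lambda>p. half_chord' p - f (mid p))"
  "vanishes 4 (\<lambda>p. half_chord' p - (f (mid p) + (1/2) *\<^sub>R D [half_chord p, half_chord p] (mid p)))"
  "vanishes 6 (\<lambda>p. half_chord' p - (f (mid p) + (1/2) *\<^sub>R D [half_chord p, half_chord p] (mid p)
     + (1/24) *\<^sub>R D [half_chord p, half_chord p, half_chord p, half_chord p] (mid p)))"
  using vanishes_half'_taylor[of 2] vanishes_half'_taylor[of 4] vanishes_half'_taylor[of 6]
  by (simp_all add: eval_nat_numeral)

lemma vanishes_mid'_expansions:
  "vanishes 1 mid'"
  "vanishes 3 (\<lambda>p. mid' p - D [half_chord p] (mid p))"
  "vanishes 5 (\<lambda>p. mid' p - (D [half_chord p] (mid p) + (1/6) *\<^sub>R D [half_chord p, half_chord p, half_chord p] (mid p)))"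
  using vanishes_mid'_taylor[of 1] vanishes_mid'_taylor[of 3] vanishes_mid'_taylor[of 5]
  by (simp_all add: eval_nat_numeral)

text \<open>\<open>mid'\<close> is O(k) and the midpoint starts at the centre, so it departs only to
  second order; this makes freezing a coefficient at the centre cheap.\<close>

lemma vanishes_mid_center: "vanishes 2 (\<lambda>p. mid p - \<phi> (fst p))"
proof -
  have "\<forall>\<^sub>F p in nhds 0. ((\<lambda>k. mid (fst p, k) - \<phi> (fst (fst p, k))) has_vector_derivative mid' p) (at (snd p))"
    using eventually_mid_deriv
  proof eventually_elim
    case (elim p)
    from has_vector_derivative_diff[OF elim has_vector_derivative_const, of "\<phi> (fst p)"]
    show ?case by simp
  qed
  from vanishes_integrate[OF this _ vanishes_mid'_expansions(1)]
  show ?thesis by (simp add: mid_0 numeral_2_eq_2)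
qed

lemma vanishes_center:
  assumes "\<And>x0. locally_lipschitz_at x0 g"
  shows "vanishes 2 (\<lambda>p. g (mid p) - g (\<phi> (fst p)))"
  by (rule vanishes_locally_lipschitz[OF assms tendsto_mid tendsto_center vanishes_mid_center])

lemma eventually_f_mid_deriv:
  "\<forall>\<^sub>F p in nhds 0. ((\<lambda>k. k *\<^sub>R f (mid (fst p, k))) has_vector_derivative
     f (mid p) + snd p *\<^sub>R D [mid' p] (mid p)) (at (snd p))"
  using eventually_mid_deriv
proof eventually_elim
  case (elim p)
  have "((\<lambda>k. f (mid (fst p, k))) has_vector_derivative D [mid' p] (mid p)) (at (snd p))"
    using has_vector_derivative_mderiv[OF smooth elim, of "[]"] by simp
  from has_vector_derivative_scaleR[OF DERIV_ident this]
  show ?case by (simp add: add.commute)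
qed

text \<open>The derivative of the difference is (d' - f(m)) - k f'(m'), and both parts are O(k^2)
  because m' = O(k).\<close>

lemma expansion3: "vanishes 3 (\<lambda>p. half_chord p - snd p *\<^sub>R f (mid p))"
proof -
  have der: "\<forall>\<^sub>F p in nhds 0. ((\<lambda>k. half_chord (fst p, k) - snd (fst p, k) *\<^sub>R f (mid (fst p, k))) has_vector_derivative
      half_chord' p - (f (mid p) + snd p *\<^sub>R D [mid' p] (mid p))) (at (snd p))"
    using eventually_half_deriv eventually_f_mid_deriv
    by eventually_elim (simp add: has_vector_derivative_diff)
  have "vanishes 2 (\<lambda>p. (half_chord' p - f (mid p)) - snd p ^ 1 *\<^sub>R D [mid' p] (mid p))"
    using vanishes_power_scaleR[OF vanishes_mderiv1[OF smooth vanishes_mid vanishes_mid'_expansions(1) order_refl], of 1]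
    by (intro vanishes_diff vanishes_half'_expansions(1)) (simp add: numeral_2_eq_2)
  then have "vanishes 2 (\<lambda>p. half_chord' p - (f (mid p) + snd p *\<^sub>R D [mid' p] (mid p)))"
    by (simp add: diff_diff_eq)
  from vanishes_integrate[OF der _ this] show ?thesis
    by (simp add: half_chord_0 numeral_3_eq_3 numeral_2_eq_2)
qed

end

section \<open>Expansion of the half chord to seventh order\<close>

context field_solution
begin

text \<open>Each d is exchanged for k f(m), one slot at a time: the exchanged slot has order 3 by
  \<open>expansion3\<close>, every other slot supplies order 1. The same telescoping gives
  \<open>vanishes_D3\<close> and \<open>vanishes_D4\<close>.\<close>

lemma vanishes_D2:
  "vanishes 4 (\<lambda>p. D [half_chord p, half_chord p] (mid p) - snd p ^ 2 *\<^sub>R D [f (mid p), f (mid p)] (mid p))"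
proof -
  let ?e = "\<lambda>p. half_chord p - snd p *\<^sub>R f (mid p)"
  have "vanishes 4 (\<lambda>p. D [?e p, half_chord p] (mid p) + snd p ^ 1 *\<^sub>R D [f (mid p), ?e p] (mid p))"
    by (intro vanishes_add vanishes_mderiv2[OF smooth vanishes_mid expansion3 vanishes_half]
        vanishes_power_scaleR_le[OF vanishes_mderiv2[OF smooth vanishes_mid vanishes_f_mid expansion3 order_refl]]) simp_all
  then show ?thesis
    by (simp add: mderiv_linear algebra_simps power2_eq_square)
qed

lemma vanishes_D3:
  "vanishes 5 (\<lambda>p. D [half_chord p, half_chord p, half_chord p] (mid p) - snd p ^ 3 *\<^sub>R D [f (mid p), f (mid p), f (mid p)] (mid p))"
proof -
  let ?e = "\<lambda>p. half_chord p - snd p *\<^sub>R f (mid p)"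
  note D3 = vanishes_mderiv3[OF smooth vanishes_mid]
  have "vanishes 5 (\<lambda>p. D [?e p, half_chord p, half_chord p] (mid p) + snd p ^ 1 *\<^sub>R D [f (mid p), ?e p, half_chord p] (mid p)
      + snd p ^ 2 *\<^sub>R D [f (mid p), f (mid p), ?e p] (mid p))"
    by (intro vanishes_add D3[OF expansion3 vanishes_half vanishes_half]
        vanishes_power_scaleR_le[OF D3[OF vanishes_f_mid expansion3 vanishes_half order_refl]]
        vanishes_power_scaleR_le[OF D3[OF vanishes_f_mid vanishes_f_mid expansion3 order_refl]]) simp_all
  then show ?thesis
    by (simp add: mderiv_linear algebra_simps power2_eq_square power3_eq_cube)
qed

lemma vanishes_D4:
  "vanishes 6 (\<lambda>p. D [half_chord p, half_chord p, half_chord p, half_chord p] (mid p)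
     - snd p ^ 4 *\<^sub>R D [f (mid p), f (mid p), f (mid p), f (mid p)] (mid p))"
proof -
  let ?e = "\<lambda>p. half_chord p - snd p *\<^sub>R f (mid p)"
  note D4 = vanishes_mderiv4[OF smooth vanishes_mid]
  have "vanishes 6 (\<lambda>p. D [?e p, half_chord p, half_chord p, half_chord p] (mid p)
      + snd p ^ 1 *\<^sub>R D [f (mid p), ?e p, half_chord p, half_chord p] (mid p)
      + snd p ^ 2 *\<^sub>R D [f (mid p), f (mid p), ?e p, half_chord p] (mid p)
      + snd p ^ 3 *\<^sub>R D [f (mid p), f (mid p), f (mid p), ?e p] (mid p))"
    by (intro vanishes_add D4[OF expansion3 vanishes_half vanishes_half vanishes_half]
        vanishes_power_scaleR_le[OF D4[OF vanishes_f_mid expansion3 vanishes_half vanishes_half order_refl]]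
        vanishes_power_scaleR_le[OF D4[OF vanishes_f_mid vanishes_f_mid expansion3 vanishes_half order_refl]]
        vanishes_power_scaleR_le[OF D4[OF vanishes_f_mid vanishes_f_mid vanishes_f_mid expansion3 order_refl]]) simp_all
  then show ?thesis
    by (simp add: mderiv_linear algebra_simps eval_nat_numeral)
qed

text \<open>The cubic coefficient is first frozen at the centre \<open>\<phi> t\<close>, so that it need not be differentiated;
  since \<open>m - \<phi> t = O(k\<^sup>2)\<close>, moving it to \<open>m\<close> costs \<open>O(k\<^sup>5)\<close>.\<close>

lemma expansion5: "vanishes 5 (\<lambda>p. half_chord p - (snd p *\<^sub>R f (mid p) + snd p ^ 3 *\<^sub>R coeff3 (mid p)))"
proof -
  let ?k = "\<lambda>p::real \<times> real. snd p"
  let ?F = "\<lambda>p. f (mid p)" and ?c = "\<lambda>p::real \<times> real. \<phi> (fst p)"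
  let ?e = "\<lambda>p. half_chord p - ?k p *\<^sub>R ?F p"
  let ?d = "\<lambda>p. half_chord' p - ((?F p + ?k p *\<^sub>R D [mid' p] (mid p)) + (3 * ?k p ^ 2) *\<^sub>R coeff3 (?c p))"
  note C = vanishes_center[OF locally_lipschitz_at_coeff3]
  note D1 = vanishes_mderiv1[OF smooth vanishes_mid _ order_refl]
  have "vanishes 4 (\<lambda>p. (half_chord' p - (?F p + (1/2) *\<^sub>R D [half_chord p, half_chord p] (mid p)))
      + (1/2) *\<^sub>R (D [half_chord p, half_chord p] (mid p) - ?k p ^ 2 *\<^sub>R D [?F p, ?F p] (mid p))
      - ?k p ^ 1 *\<^sub>R D [mid' p - D [half_chord p] (mid p)] (mid p)
      - ?k p ^ 1 *\<^sub>R D [D [?e p] (mid p)] (mid p)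
      + 3 *\<^sub>R (?k p ^ 2 *\<^sub>R (coeff3 (mid p) - coeff3 (?c p))))"
    by (intro vanishes_add vanishes_diff vanishes_scaleR vanishes_half'_expansions(2) vanishes_D2
        vanishes_power_scaleR_le[OF D1[OF vanishes_mid'_expansions(2)]]
        vanishes_power_scaleR_le[OF D1[OF D1[OF expansion3]]] vanishes_power_scaleR_le[OF C]) simp_all
  moreover have "(half_chord' p - (?F p + (1/2) *\<^sub>R D [half_chord p, half_chord p] (mid p)))
      + (1/2) *\<^sub>R (D [half_chord p, half_chord p] (mid p) - ?k p ^ 2 *\<^sub>R D [?F p, ?F p] (mid p))
      - ?k p ^ 1 *\<^sub>R D [mid' p - D [half_chord p] (mid p)] (mid p)
      - ?k p ^ 1 *\<^sub>R D [D [?e p] (mid p)] (mid p)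
      + 3 *\<^sub>R (?k p ^ 2 *\<^sub>R (coeff3 (mid p) - coeff3 (?c p))) = ?d p" for p
    by (rule euclidean_eqI)
      (simp add: coeff3_def[of "mid p"] mderiv_linear inner_add_left inner_diff_left algebra_simps power2_eq_square)
  ultimately have d: "vanishes 4 ?d"
    by (simp only:)
  have "\<forall>\<^sub>F p in nhds 0. ((\<lambda>k. half_chord (fst p, k)
      - (?k (fst p, k) *\<^sub>R ?F (fst p, k) + ?k (fst p, k) ^ 3 *\<^sub>R coeff3 (?c (fst p, k)))) has_vector_derivative ?d p) (at (snd p))"
    using eventually_half_deriv eventually_f_mid_deriv
  proof eventually_elim
    case (elim p)
    have "((\<lambda>k. k ^ 3) has_real_derivative 3 * snd p ^ 2) (at (snd p))"
      by (auto intro!: derivative_eq_intros)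
    from has_vector_derivative_scaleR[OF this has_vector_derivative_const[of "coeff3 (?c p)"]]
    have "((\<lambda>k. k ^ 3 *\<^sub>R coeff3 (?c p)) has_vector_derivative (3 * snd p ^ 2) *\<^sub>R coeff3 (?c p)) (at (snd p))"
      by simp
    from has_vector_derivative_diff[OF elim(1) has_vector_derivative_add[OF elim(2) this]]
    show ?case by simp
  qed
  from vanishes_integrate[OF this _ d]
  have "vanishes 5 (\<lambda>p. half_chord p - (?k p *\<^sub>R ?F p + ?k p ^ 3 *\<^sub>R coeff3 (?c p)))"
    by (simp add: half_chord_0)
  moreover have "vanishes 5 (\<lambda>p. ?k p ^ 3 *\<^sub>R (coeff3 (mid p) - coeff3 (?c p)))"
    by (rule vanishes_power_scaleR_le[OF C]) simp
  ultimately have "vanishes 5 (\<lambda>p. (half_chord p - (?k p *\<^sub>R ?F p + ?k p ^ 3 *\<^sub>R coeff3 (?c p)))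
      - ?k p ^ 3 *\<^sub>R (coeff3 (mid p) - coeff3 (?c p)))"
    by (rule vanishes_diff)
  then show ?thesis
    by (simp add: algebra_simps)
qed

text \<open>Inserting d = k f + k^3 c_3 with error O(k^5), the two cross terms merge by symmetry
  into 2 k^4 f''(f, c_3), while k^6 f''(c_3, c_3) already has the required order.\<close>

lemma vanishes_D2_refined:
  "vanishes 6 (\<lambda>p. D [half_chord p, half_chord p] (mid p) - (snd p ^ 2 *\<^sub>R D [f (mid p), f (mid p)] (mid p)
     + (2 * snd p ^ 4) *\<^sub>R D [f (mid p), coeff3 (mid p)] (mid p)))"
proof -
  let ?a = "\<lambda>p. snd p *\<^sub>R f (mid p) + snd p ^ 3 *\<^sub>R coeff3 (mid p)"
  let ?g = "\<lambda>p. half_chord p - ?a p"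
  note D2 = vanishes_mderiv2[OF smooth vanishes_mid]
  note C3 = vanishes_coeff3[OF vanishes_mid]
  have "vanishes 6 (\<lambda>p. D [?g p, half_chord p] (mid p) + snd p ^ 1 *\<^sub>R D [f (mid p), ?g p] (mid p)
      + snd p ^ 3 *\<^sub>R D [coeff3 (mid p), ?g p] (mid p) + snd p ^ 6 *\<^sub>R D [coeff3 (mid p), coeff3 (mid p)] (mid p))"
    by (intro vanishes_add D2[OF expansion5 vanishes_half]
        vanishes_power_scaleR_le[OF D2[OF vanishes_f_mid expansion5 order_refl]]
        vanishes_power_scaleR_le[OF D2[OF C3 expansion5 order_refl]]
        vanishes_power_scaleR_le[OF D2[OF C3 C3 order_refl]]) simp_all
  moreover have "D [?g p, half_chord p] (mid p) + snd p ^ 1 *\<^sub>R D [f (mid p), ?g p] (mid p)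
      + snd p ^ 3 *\<^sub>R D [coeff3 (mid p), ?g p] (mid p) + snd p ^ 6 *\<^sub>R D [coeff3 (mid p), coeff3 (mid p)] (mid p)
      = D [half_chord p, half_chord p] (mid p) - (snd p ^ 2 *\<^sub>R D [f (mid p), f (mid p)] (mid p)
     + (2 * snd p ^ 4) *\<^sub>R D [f (mid p), coeff3 (mid p)] (mid p))" for p
    by (rule euclidean_eqI)
      (simp add: mderiv_linear inner_add_left inner_diff_left algebra_simps eval_nat_numeral
        mderiv_swap2[OF smooth, of "coeff3 (mid p)" "f (mid p)"])
  ultimately show ?thesis
    by (simp only:)
qed

text \<open>Freezing c_3 would cost O(k^5), too much here. It stays at the moving midpoint, and its
  derivative contributes at order k^4. Only c_5 is frozen, at cost O(k^7).\<close>

lemma expansion7: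
  "vanishes 7 (\<lambda>p. half_chord p - (snd p *\<^sub>R f (mid p) + snd p ^ 3 *\<^sub>R coeff3 (mid p) + snd p ^ 5 *\<^sub>R coeff5 (mid p)))"
proof -
  let ?k = "\<lambda>p::real \<times> real. snd p"
  let ?F = "\<lambda>p. f (mid p)" and ?c = "\<lambda>p::real \<times> real. \<phi> (fst p)"
  let ?e = "\<lambda>p. half_chord p - ?k p *\<^sub>R ?F p"
  let ?g = "\<lambda>p. half_chord p - (?k p *\<^sub>R ?F p + ?k p ^ 3 *\<^sub>R coeff3 (mid p))"
  let ?h2 = "\<lambda>p. D [half_chord p, half_chord p] (mid p)" and ?h3 = "\<lambda>p. D [half_chord p, half_chord p, half_chord p] (mid p)"
    and ?h4 = "\<lambda>p. D [half_chord p, half_chord p, half_chord p, half_chord p] (mid p)"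
  let ?d = "\<lambda>p. half_chord' p - ((?F p + ?k p *\<^sub>R D [mid' p] (mid p))
      + ((3 * ?k p ^ 2) *\<^sub>R coeff3 (mid p) + ?k p ^ 3 *\<^sub>R coeff3_deriv (mid p) (mid' p)) + (5 * ?k p ^ 4) *\<^sub>R coeff5 (?c p))"
  note C = vanishes_center[OF locally_lipschitz_at_coeff5]
  note D1 = vanishes_mderiv1[OF smooth vanishes_mid _ order_refl]
  \<comment> \<open>Bookkeeping as in \<open>expansion5\<close>, two orders further:
    \<open>coeff3\<close> cancels what remains at k^2 and \<open>coeff5\<close> what remains at
    k^4.\<close>
  let ?r = "\<lambda>p. (half_chord' p - (?F p + (1/2) *\<^sub>R ?h2 p + (1/24) *\<^sub>R ?h4 p))
      + (1/2) *\<^sub>R (?h2 p - (?k p ^ 2 *\<^sub>R D [?F p, ?F p] (mid p) + (2 * ?k p ^ 4) *\<^sub>R D [?F p, coeff3 (mid p)] (mid p)))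
      + (1/24) *\<^sub>R (?h4 p - ?k p ^ 4 *\<^sub>R D [?F p, ?F p, ?F p, ?F p] (mid p))
      - ?k p ^ 1 *\<^sub>R D [mid' p - (D [half_chord p] (mid p) + (1/6) *\<^sub>R ?h3 p)] (mid p)
      - ?k p ^ 1 *\<^sub>R D [D [?g p] (mid p)] (mid p)
      - (1/6) *\<^sub>R (?k p ^ 1 *\<^sub>R D [?h3 p - ?k p ^ 3 *\<^sub>R D [?F p, ?F p, ?F p] (mid p)] (mid p))
      - ?k p ^ 3 *\<^sub>R coeff3_deriv (mid p) ((mid' p - D [half_chord p] (mid p)) + D [?e p] (mid p))
      + 5 *\<^sub>R (?k p ^ 4 *\<^sub>R (coeff5 (mid p) - coeff5 (?c p)))"
  have "vanishes 6 ?r"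
    by (intro vanishes_add vanishes_diff vanishes_scaleR vanishes_half'_expansions(3) vanishes_D2_refined vanishes_D4
        vanishes_power_scaleR_le[OF D1[OF vanishes_mid'_expansions(3)]]
        vanishes_power_scaleR_le[OF D1[OF D1[OF expansion5]]]
        vanishes_power_scaleR_le[OF D1[OF vanishes_D3]]
        vanishes_power_scaleR_le[OF vanishes_coeff3_deriv[OF vanishes_mid vanishes_add[OF vanishes_mid'_expansions(2) D1[OF expansion3]]]]
        vanishes_power_scaleR_le[OF C]) simp_all
  moreover have "?r p = ?d p" for p
  proof (rule euclidean_eqI)
    fix b :: 'a
    have e3: "coeff3 (mid p) \<bullet> b = (1/6) * (D [?F p, ?F p] (mid p) \<bullet> b) - (1/3) * (D [D [?F p] (mid p)] (mid p) \<bullet> b)"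
      by (simp add: coeff3_def inner_diff_left)
    have e5: "coeff5 (mid p) \<bullet> b = (1/5) * (D [?F p, coeff3 (mid p)] (mid p) \<bullet> b
        + (1/24) * (D [?F p, ?F p, ?F p, ?F p] (mid p) \<bullet> b) - D [D [coeff3 (mid p)] (mid p)] (mid p) \<bullet> b
        - (1/6) * (D [D [?F p, ?F p, ?F p] (mid p)] (mid p) \<bullet> b) - coeff3_deriv (mid p) (D [?F p] (mid p)) \<bullet> b)"
      by (simp add: coeff5_def inner_diff_left inner_add_left)
    have "coeff3_deriv x (v - w) = coeff3_deriv x v - coeff3_deriv x w" for x v w
      using coeff3_deriv_linear(1)[of x "v - w" w] by (simp add: algebra_simps)
    then show "?r p \<bullet> b = ?d p \<bullet> b"
      by (simp add: mderiv_linear coeff3_deriv_linear inner_add_left inner_diff_left e3 e5)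
        (simp add: field_simps eval_nat_numeral)
  qed
  ultimately have d: "vanishes 6 ?d"
    by (simp only:)
  have "\<forall>\<^sub>F p in nhds 0. ((\<lambda>k. half_chord (fst p, k) - (?k (fst p, k) *\<^sub>R ?F (fst p, k)
      + ?k (fst p, k) ^ 3 *\<^sub>R coeff3 (mid (fst p, k)) + ?k (fst p, k) ^ 5 *\<^sub>R coeff5 (?c (fst p, k))))
      has_vector_derivative ?d p) (at (snd p))"
    using eventually_half_deriv eventually_f_mid_deriv eventually_mid_deriv
  proof eventually_elim
    case (elim p)
    have k3: "((\<lambda>k. k ^ 3) has_real_derivative 3 * snd p ^ 2) (at (snd p))"
      by (auto intro!: derivative_eq_intros)
    have k5: "((\<lambda>k. k ^ 5) has_real_derivative 5 * snd p ^ 4) (at (snd p))"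
      by (auto intro!: derivative_eq_intros)
    from has_vector_derivative_scaleR[OF k3 has_vector_derivative_coeff3[OF elim(3)]]
    have 3: "((\<lambda>k. k ^ 3 *\<^sub>R coeff3 (mid (fst p, k))) has_vector_derivative
        (3 * snd p ^ 2) *\<^sub>R coeff3 (mid p) + snd p ^ 3 *\<^sub>R coeff3_deriv (mid p) (mid' p)) (at (snd p))"
      by (simp add: add.commute)
    from has_vector_derivative_scaleR[OF k5 has_vector_derivative_const[of "coeff5 (?c p)"]]
    have 5: "((\<lambda>k. k ^ 5 *\<^sub>R coeff5 (?c p)) has_vector_derivative (5 * snd p ^ 4) *\<^sub>R coeff5 (?c p)) (at (snd p))"
      by simp
    from has_vector_derivative_diff[OF elim(1) has_vector_derivative_add[OF has_vector_derivative_add[OF elim(2) 3] 5]]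
    show ?case by simp
  qed
  from vanishes_integrate[OF this _ d]
  have "vanishes 7 (\<lambda>p. half_chord p - (?k p *\<^sub>R ?F p + ?k p ^ 3 *\<^sub>R coeff3 (mid p) + ?k p ^ 5 *\<^sub>R coeff5 (?c p)))"
    by (simp add: half_chord_0)
  moreover have "vanishes 7 (\<lambda>p. ?k p ^ 5 *\<^sub>R (coeff5 (mid p) - coeff5 (?c p)))"
    by (rule vanishes_power_scaleR_le[OF C]) simp
  ultimately have "vanishes 7 (\<lambda>p. (half_chord p - (?k p *\<^sub>R ?F p + ?k p ^ 3 *\<^sub>R coeff3 (mid p) + ?k p ^ 5 *\<^sub>R coeff5 (?c p)))
      - ?k p ^ 5 *\<^sub>R (coeff5 (mid p) - coeff5 (?c p)))"
    by (rule vanishes_diff)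
  then show ?thesis
    by (simp add: algebra_simps)
qed

definition average :: "real \<times> real \<Rightarrow> 'a" where
  "average p = integral {0..1} (\<lambda>\<xi>. f (\<xi> *\<^sub>R (mid p + half_chord p) + (1 - \<xi>) *\<^sub>R (mid p - half_chord p)))"

text \<open>Half the defect of the exact solution in the equation of the method, for a step h = 2k
  centred at \<open>t\<close>.\<close>

lemma residual:
  "vanishes 7 (\<lambda>p. half_chord p - (snd p *\<^sub>R average p - (snd p ^ 3 / 3) *\<^sub>R D [D [average p] (mid p)] (mid p)
     + (snd p ^ 5 / 45) *\<^sub>R avf5 (mid p) (average p)))"
proof -
  let ?k = "\<lambda>p::real \<times> real. snd p"
  let ?F = "\<lambda>p. f (mid p)"
  let ?h2 = "\<lambda>p. D [half_chord p, half_chord p] (mid p)"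
    and ?h4 = "\<lambda>p. D [half_chord p, half_chord p, half_chord p, half_chord p] (mid p)"
  let ?F2 = "\<lambda>p. D [?F p, ?F p] (mid p)" and ?F4 = "\<lambda>p. D [?F p, ?F p, ?F p, ?F p] (mid p)"
  let ?J = "\<lambda>p. average p - (?F p + (1/6) *\<^sub>R ?h2 p + (1/120) *\<^sub>R ?h4 p)"
  note D1 = vanishes_mderiv1[OF smooth vanishes_mid _ order_refl]
  have J: "vanishes 6 ?J"
    unfolding average_def by (rule vanishes_segment_average[OF vanishes_mid vanishes_half])
  have h2: "vanishes 2 ?h2"
    by (rule vanishes_mderiv2[OF smooth vanishes_mid vanishes_half vanishes_half]) simp
  have h4: "vanishes 4 ?h4"
    by (rule vanishes_mderiv4[OF smooth vanishes_mid vanishes_half vanishes_half vanishes_half vanishes_half]) simp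
  \<comment> \<open>\<open>average\<close> is multiplied by k, k^3 and k^5, so it must be known with
    errors of order 6, 4 and 2 only: \<open>J\<close>, \<open>J4\<close> and
    \<open>J2\<close>.\<close>
  have J4: "vanishes 4 (\<lambda>p. ?J p + (1/6) *\<^sub>R (?h2 p - ?k p ^ 2 *\<^sub>R ?F2 p) + (1/120) *\<^sub>R ?h4 p)"
    by (intro vanishes_add vanishes_scaleR vanishes_D2 h4 vanishes_mono[OF J]) simp
  have J2: "vanishes 2 (\<lambda>p. ?J p + (1/6) *\<^sub>R ?h2 p + (1/120) *\<^sub>R ?h4 p)"
    by (intro vanishes_add vanishes_scaleR h2 vanishes_mono[OF h4] vanishes_mono[OF J]) simp_all
  let ?r = "\<lambda>p. (half_chord p - (?k p *\<^sub>R ?F p + ?k p ^ 3 *\<^sub>R coeff3 (mid p) + ?k p ^ 5 *\<^sub>R coeff5 (mid p)))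
      - ?k p ^ 1 *\<^sub>R ?J p
      - (1/6) *\<^sub>R (?k p ^ 1 *\<^sub>R (?h2 p - (?k p ^ 2 *\<^sub>R ?F2 p + (2 * ?k p ^ 4) *\<^sub>R D [?F p, coeff3 (mid p)] (mid p))))
      - (1/120) *\<^sub>R (?k p ^ 1 *\<^sub>R (?h4 p - ?k p ^ 4 *\<^sub>R ?F4 p))
      + (1/3) *\<^sub>R (?k p ^ 3 *\<^sub>R D [D [?J p + (1/6) *\<^sub>R (?h2 p - ?k p ^ 2 *\<^sub>R ?F2 p) + (1/120) *\<^sub>R ?h4 p] (mid p)] (mid p))
      - (1/45) *\<^sub>R (?k p ^ 5 *\<^sub>R avf5 (mid p) (?J p + (1/6) *\<^sub>R ?h2 p + (1/120) *\<^sub>R ?h4 p))"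
  have "vanishes 7 ?r"
    by (intro vanishes_add vanishes_diff vanishes_scaleR expansion7
        vanishes_power_scaleR_le[OF J] vanishes_power_scaleR_le[OF vanishes_D2_refined]
        vanishes_power_scaleR_le[OF vanishes_D4] vanishes_power_scaleR_le[OF D1[OF D1[OF J4]]]
        vanishes_power_scaleR_le[OF vanishes_avf5[OF vanishes_mid J2]]) simp_all
  moreover have "?r p = half_chord p - (?k p *\<^sub>R average p - (?k p ^ 3 / 3) *\<^sub>R D [D [average p] (mid p)] (mid p)
     + (?k p ^ 5 / 45) *\<^sub>R avf5 (mid p) (average p))" for p
  proof (rule euclidean_eqI)
    fix b :: 'a
    have e3: "coeff3 (mid p) \<bullet> b = (1/6) * (?F2 p \<bullet> b) - (1/3) * (D [D [?F p] (mid p)] (mid p) \<bullet> b)"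
      by (simp add: coeff3_def inner_diff_left)
    \<comment> \<open>These are the k^5 terms of the method: f''(d,d)/6 gives (1/3) f''(f, c_3), the
      fourth derivative keeps 1/120, the part k^2 f''(f,f)/6 of the average under -(k^3/3) f'f'
      gives -1/18, and k^5/45 acts on f alone.\<close>
    have e5: "coeff5 (mid p) \<bullet> b = (1/3) * (D [?F p, coeff3 (mid p)] (mid p) \<bullet> b) + (1/120) * (?F4 p \<bullet> b)
        - (1/18) * (D [D [?F2 p] (mid p)] (mid p) \<bullet> b) + (1/45) * (avf5 (mid p) (?F p) \<bullet> b)"
      by (simp add: coeff5_eq_avf5 inner_diff_left inner_add_left)
    have q: "avf5 (mid p) (?J p + (1/6) *\<^sub>R ?h2 p + (1/120) *\<^sub>R ?h4 p) = avf5 (mid p) (average p) - avf5 (mid p) (?F p)"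
      using avf5_linear[of "mid p" "?J p + (1/6) *\<^sub>R ?h2 p + (1/120) *\<^sub>R ?h4 p" "?F p"] by (simp add: algebra_simps)
    show "?r p \<bullet> b = (half_chord p - (?k p *\<^sub>R average p - (?k p ^ 3 / 3) *\<^sub>R D [D [average p] (mid p)] (mid p)
     + (?k p ^ 5 / 45) *\<^sub>R avf5 (mid p) (average p))) \<bullet> b"
      unfolding q
      by (simp add: mderiv_linear inner_add_left inner_diff_left e3 e5)
        (simp add: field_simps eval_nat_numeral)
  qed
  ultimately show ?thesis
    by (simp only:)
qed

end

section \<open>The numerical solution\<close>

context smooth_field
begin

text \<open>\<open>z0\<close> is both the fixed end of the chord and the centre of the ball, so
  chords stay in the ball and corresponding points differ by \<xi> (x - y); the constant of
  \<open>f\<close> is inherited.\<close>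

lemma locally_lipschitz_at_average:
  "locally_lipschitz_at z0 (\<lambda>z. integral {0..1} (\<lambda>\<xi>. f (\<xi> *\<^sub>R z + (1 - \<xi>) *\<^sub>R z0)))"
proof -
  obtain L where L: "L-lipschitz_on (cball z0 1) f"
    using lipschitz_on_cball_smooth[OF smooth] by blast
  have L0: "L \<ge> 0" using lipschitz_on_nonneg[OF L] .
  let ?g = "\<lambda>z \<xi>. f (\<xi> *\<^sub>R z + (1 - \<xi>) *\<^sub>R z0)"
  have int: "(?g z has_integral integral {0..1} (?g z)) {0..1}" for z
    by (intro integrable_integral integrable_continuous_real
        continuous_on_compose2[OF continuous_on_mderiv[OF smooth, of UNIV "[]", unfolded mderiv.simps(1)[abs_def]]]
        continuous_intros) auto
  have "L-lipschitz_on (cball z0 1) (\<lambda>z. integral {0..1} (?g z))"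
  proof (rule lipschitz_onI)
    fix x y assume x: "x \<in> cball z0 1" and y: "y \<in> cball z0 1"
    have "norm (integral {0..1} (?g x) - integral {0..1} (?g y))
        \<le> (L * dist x y) * Henstock_Kurzweil_Integration.content {0..1::real}"
    proof (rule has_integral_bound_real[OF _ finite.emptyI has_integral_diff[OF int int]])
      show "0 \<le> L * dist x y" using L0 by simp
      fix \<xi> :: real assume "\<xi> \<in> {0..1} - {}"
      then have \<xi>: "0 \<le> \<xi>" "\<xi> \<le> 1" by auto
      have "norm (?g x \<xi> - ?g y \<xi>) \<le> L * norm ((\<xi> *\<^sub>R x + (1 - \<xi>) *\<^sub>R z0) - (\<xi> *\<^sub>R y + (1 - \<xi>) *\<^sub>R z0))"
        using \<xi> x y by (intro lipschitz_on_normD[OF L] convexD convex_cball) auto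
      also have "(\<xi> *\<^sub>R x + (1 - \<xi>) *\<^sub>R z0) - (\<xi> *\<^sub>R y + (1 - \<xi>) *\<^sub>R z0) = \<xi> *\<^sub>R (x - y)"
        by (simp add: algebra_simps)
      also have "L * norm (\<xi> *\<^sub>R (x - y)) \<le> L * dist x y"
        using \<xi> L0 by (intro mult_left_mono) (auto simp: dist_norm mult_left_le_one_le)
      finally show "norm (?g x \<xi> - ?g y \<xi>) \<le> L * dist x y" .
    qed
    then show "dist (integral {0..1} (?g x)) (integral {0..1} (?g y)) \<le> L * dist x y"
      by (simp add: dist_norm)
  qed (rule L0)
  then show ?thesis
    unfolding locally_lipschitz_at_def using zero_less_one by blast
qed

text \<open>The increment of the method with each matrix replaced by its action;
  \<open>avf6_matrix_mult\<close> gives the link.\<close>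

definition avf_step :: "'a \<Rightarrow> real \<Rightarrow> 'a \<Rightarrow> 'a" where
  "avf_step z0 h z = (let x = (1/2) *\<^sub>R (z0 + z);
       J = integral {0..1} (\<lambda>\<xi>. f (\<xi> *\<^sub>R z + (1 - \<xi>) *\<^sub>R z0))
     in h *\<^sub>R J - (h ^ 3 / 12) *\<^sub>R D [D [J] x] x + (h ^ 5 / 720) *\<^sub>R avf5 x J)"

text \<open>For \<bar>h\<bar> \<le> 1 the factors of h^3 and h^5 are dominated by \<bar>h\<bar>;
  this common factor makes the step a contraction for small \<open>h\<close>.\<close>

lemma step_lipschitz:
  "\<exists>r>0. \<exists>L\<ge>0. \<forall>h x y. \<bar>h\<bar> \<le> 1 \<longrightarrow> x \<in> cball z0 r \<longrightarrow> y \<in> cball z0 r \<longrightarrow>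
     norm (avf_step z0 h x - avf_step z0 h y) \<le> \<bar>h\<bar> * L * norm (x - y)"
proof -
  let ?m = "\<lambda>z. (1/2) *\<^sub>R (z0 + z)"
  let ?J = "\<lambda>z. integral {0..1} (\<lambda>\<xi>. f (\<xi> *\<^sub>R z + (1 - \<xi>) *\<^sub>R z0))"
  let ?D = "\<lambda>z. D [D [?J z] (?m z)] (?m z)"
  let ?avf5 = "\<lambda>z. avf5 (?m z) (?J z)"
  have m: "locally_lipschitz_at z0 ?m"
    by (intro locally_lipschitz_at_scale locally_lipschitz_at_add locally_lipschitz_at_const locally_lipschitz_at_ident)
  note J = locally_lipschitz_at_average[of z0]
  have D: "locally_lipschitz_at z0 ?D"
    by (intro locally_lipschitz_at_mderiv(2)[OF smooth m] J)
  have avf5: "locally_lipschitz_at z0 ?avf5"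
    by (rule locally_lipschitz_at_avf5[OF m J])
  obtain r1 L1 where 1: "r1 > 0" "\<forall>r\<le>r1. L1-lipschitz_on (cball z0 r) ?J"
    using locally_lipschitz_at_lipschitz_on[OF J] by (elim exE conjE)
  obtain r2 L2 where 2: "r2 > 0" "\<forall>r\<le>r2. L2-lipschitz_on (cball z0 r) ?D"
    using locally_lipschitz_at_lipschitz_on[OF D] by (elim exE conjE)
  obtain r3 L3 where 3: "r3 > 0" "\<forall>r\<le>r3. L3-lipschitz_on (cball z0 r) ?avf5"
    using locally_lipschitz_at_lipschitz_on[OF avf5] by (elim exE conjE)
  define r where "r = min r1 (min r2 r3)"
  have r: "r > 0" "r \<le> r1" "r \<le> r2" "r \<le> r3"
    using 1(1) 2(1) 3(1) by (auto simp: r_def)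
  note lip = 1(2)[rule_format, OF r(2)] 2(2)[rule_format, OF r(3)] 3(2)[rule_format, OF r(4)]
  note nn = lip[THEN lipschitz_on_nonneg]
  have "norm (avf_step z0 h x - avf_step z0 h y) \<le> \<bar>h\<bar> * (L1 + L2 + L3) * norm (x - y)"
    if h: "\<bar>h\<bar> \<le> 1" and x: "x \<in> cball z0 r" and y: "y \<in> cball z0 r" for h x y
  proof -
    have pow: "\<bar>h ^ 3 / 12\<bar> \<le> \<bar>h\<bar>" "\<bar>h ^ 5 / 720\<bar> \<le> \<bar>h\<bar>"
      using power_decreasing[of 1 3 "\<bar>h\<bar>"] power_decreasing[of 1 5 "\<bar>h\<bar>"] h
      by (simp_all add: power_abs)
    have eq: "avf_step z0 h x - avf_step z0 h y = h *\<^sub>R (?J x - ?J y) - (h ^ 3 / 12) *\<^sub>R (?D x - ?D y)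
        + (h ^ 5 / 720) *\<^sub>R (?avf5 x - ?avf5 y)"
      by (simp add: avf_step_def Let_def scaleR_diff_right)
    have "norm (avf_step z0 h x - avf_step z0 h y) \<le> norm (h *\<^sub>R (?J x - ?J y)) + norm ((h ^ 3 / 12) *\<^sub>R (?D x - ?D y))
        + norm ((h ^ 5 / 720) *\<^sub>R (?avf5 x - ?avf5 y))"
      unfolding eq by (rule order_trans[OF norm_triangle_ineq add_right_mono[OF norm_triangle_ineq4]])
    also have "\<dots> \<le> \<bar>h\<bar> * (L1 * norm (x - y)) + \<bar>h\<bar> * (L2 * norm (x - y)) + \<bar>h\<bar> * (L3 * norm (x - y))"
      unfolding norm_scaleR
      by (intro add_mono mult_mono order_refl pow lipschitz_on_normD[OF lip(1) x y]
          lipschitz_on_normD[OF lip(2) x y] lipschitz_on_normD[OF lip(3) x y] abs_ge_zero norm_ge_zero)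
    finally show ?thesis
      by (simp add: algebra_simps)
  qed
  with r(1) nn show ?thesis
    by (intro exI[of _ r] conjI exI[of _ "L1 + L2 + L3"]) auto
qed

end

context field_solution
begin

text \<open>At p = (h/2, h/2) the chord runs from \<phi>(0) to \<phi>(h). Doubling
  \<open>residual\<close> restores the method: 2 (h/2)^3/3 = h^3/12 and 2 (h/2)^5/45 =
  h^5/720.\<close>

lemma step_residual:
  "\<exists>C\<ge>0. \<forall>\<^sub>F h in nhds 0. norm (\<phi> h - \<phi> 0 - avf_step (\<phi> 0) h (\<phi> h)) \<le> C * \<bar>h\<bar> ^ 7"
proof -
  obtain C where C: "C \<ge> 0" "\<forall>\<^sub>F p in nhds 0. norm (half_chord p - (snd p *\<^sub>R average p
      - (snd p ^ 3 / 3) *\<^sub>R D [D [average p] (mid p)] (mid p)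
      + (snd p ^ 5 / 45) *\<^sub>R avf5 (mid p) (average p))) \<le> C * \<bar>snd p\<bar> ^ 7"
    by (rule vanishesE[OF residual])
  have "((\<lambda>h::real. (h / 2, h / 2)) \<longlongrightarrow> (0 / 2, 0 / 2)) (nhds 0)"
    by (intro tendsto_intros filterlim_ident) simp_all
  then have lim: "((\<lambda>h::real. (h / 2, h / 2)) \<longlongrightarrow> 0) (nhds 0)"
    by (simp add: zero_prod_def)
  have "\<forall>\<^sub>F h in nhds 0. norm (\<phi> h - \<phi> 0 - avf_step (\<phi> 0) h (\<phi> h)) \<le> (2 * C / 2 ^ 7) * \<bar>h\<bar> ^ 7"
    using eventually_compose_filterlim[OF C(2) lim]
  proof eventually_elim
    case (elim h)
    let ?p = "(h / 2, h / 2)"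
    let ?R = "half_chord ?p - (snd ?p *\<^sub>R average ?p
      - (snd ?p ^ 3 / 3) *\<^sub>R D [D [average ?p] (mid ?p)] (mid ?p)
      + (snd ?p ^ 5 / 45) *\<^sub>R avf5 (mid ?p) (average ?p))"
    have "average ?p = integral {0..1} (\<lambda>\<xi>. f (\<xi> *\<^sub>R \<phi> h + (1 - \<xi>) *\<^sub>R \<phi> 0))"
      by (simp add: average_def mid_plus_half)
    moreover have "mid ?p = (1/2) *\<^sub>R (\<phi> 0 + \<phi> h)"
      by (simp add: mid_def add.commute)
    moreover have "2 *\<^sub>R half_chord ?p = \<phi> h - \<phi> 0"
      by (simp add: half_chord_def)
    ultimately have "\<phi> h - \<phi> 0 - avf_step (\<phi> 0) h (\<phi> h) = 2 *\<^sub>R ?R"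
      by (simp add: avf_step_def Let_def scaleR_diff_right scaleR_add_right power_divide)
    then have "norm (\<phi> h - \<phi> 0 - avf_step (\<phi> 0) h (\<phi> h)) = 2 * norm ?R"
      by (simp only: norm_scaleR)
    also have "\<dots> \<le> 2 * (C * \<bar>h / 2\<bar> ^ 7)"
      using elim by simp
    finally show ?case
      by (simp add: power_divide)
  qed
  with C(1) show ?thesis
    by (intro exI[of _ "2 * C / 2 ^ 7"]) simp
qed

lemma step_solution_error:
  assumes lim: "(\<Phi> \<longlongrightarrow> \<phi> 0) (at 0)"
    and eq: "\<forall>\<^sub>F h in at 0. \<Phi> h = \<phi> 0 + avf_step (\<phi> 0) h (\<Phi> h)"
  shows "(\<lambda>h. norm (\<Phi> h - \<phi> h)) \<in> O[at 0](\<lambda>h. h ^ 7)"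
proof -
  obtain C where C: "C \<ge> 0"
    "\<forall>\<^sub>F h in nhds 0. norm (\<phi> h - \<phi> 0 - avf_step (\<phi> 0) h (\<phi> h)) \<le> C * \<bar>h\<bar> ^ 7"
    using step_residual by blast
  obtain r L where r: "r > 0" and L: "L \<ge> 0"
    and lip: "\<And>h x y. \<bar>h\<bar> \<le> 1 \<Longrightarrow> x \<in> cball (\<phi> 0) r \<Longrightarrow> y \<in> cball (\<phi> 0) r \<Longrightarrow>
      norm (avf_step (\<phi> 0) h x - avf_step (\<phi> 0) h y) \<le> \<bar>h\<bar> * L * norm (x - y)"
    using step_lipschitz[of "\<phi> 0"] by blast
  \<comment> \<open>Gives \<bar>h\<bar> L \<le> 1/2, so that E \<le> \<bar>h\<bar> L E + norm R can
    be solved for the error: E \<le> 2 norm R.\<close>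
  define \<delta> where "\<delta> = min 1 (1 / (2 * (L + 1)))"
  have \<delta>: "\<delta> > 0" "\<delta> \<le> 1" "\<delta> \<le> 1 / (2 * (L + 1))"
    using L by (auto simp: \<delta>_def)
  have small: "\<forall>\<^sub>F h in at (0::real). \<bar>h\<bar> < \<delta>"
    using tendstoD[OF tendsto_ident_at \<delta>(1), of "0::real" UNIV] by (simp add: dist_norm)
  have phi: "(\<phi> \<longlongrightarrow> \<phi> 0) (at 0)"
    using tendsto_solution by (simp add: tendsto_at_iff_tendsto_nhds)
  have res: "\<forall>\<^sub>F h in at 0. norm (\<phi> h - \<phi> 0 - avf_step (\<phi> 0) h (\<phi> h)) \<le> C * \<bar>h\<bar> ^ 7"
    using C(2) by (simp add: eventually_at_filter eventually_mono)
  have "\<forall>\<^sub>F h in at 0. norm (norm (\<Phi> h - \<phi> h)) \<le> (2 * C) * norm (h ^ 7)"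
    using eq small res tendstoD[OF lim r] tendstoD[OF phi r]
  proof eventually_elim
    case (elim h)
    let ?E = "norm (\<Phi> h - \<phi> h)"
    let ?R = "\<phi> h - \<phi> 0 - avf_step (\<phi> 0) h (\<phi> h)"
    have "?E = norm ((avf_step (\<phi> 0) h (\<Phi> h) - avf_step (\<phi> 0) h (\<phi> h)) - ?R)"
      using elim(1) by (simp add: algebra_simps)
    also have "\<dots> \<le> norm (avf_step (\<phi> 0) h (\<Phi> h) - avf_step (\<phi> 0) h (\<phi> h)) + norm ?R"
      by (rule norm_triangle_ineq4)
    also have "norm (avf_step (\<phi> 0) h (\<Phi> h) - avf_step (\<phi> 0) h (\<phi> h)) \<le> \<bar>h\<bar> * L * ?E"
      using elim \<delta> by (intro lip) (auto simp: dist_commute)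
    also have "\<bar>h\<bar> * L * ?E \<le> (1/2) * ?E"
    proof (rule mult_right_mono)
      have "\<bar>h\<bar> * L \<le> (1 / (2 * (L + 1))) * L"
        using elim(2) \<delta>(3) L by (intro mult_right_mono) auto
      also have "\<dots> \<le> 1/2"
        using L by (simp add: field_simps)
      finally show "\<bar>h\<bar> * L \<le> 1/2" .
    qed simp
    finally have "?E \<le> 2 * norm ?R" by simp
    also have "\<dots> \<le> 2 * (C * \<bar>h\<bar> ^ 7)"
      using elim(3) by simp
    finally show ?case
      by (simp add: power_abs)
  qed
  then show ?thesis by (rule bigoI)
qed

end

text \<open>\<open>matrix g\<close> acts as \<open>g\<close> when \<open>g\<close> is linear.
  Linearity of the nested maps is assembled by \<open>l\<close>, which inserts a linear map into any
  slot of a derivative.\<close>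

lemma avf6_matrix_mult:
  fixes f :: "real ^ 'n \<Rightarrow> real ^ 'n"
  assumes f: "smooth_on UNIV f"
  shows "avf6_matrix f h x *v w = h *\<^sub>R w - (h ^ 3 / 12) *\<^sub>R mderiv f [mderiv f [w] x] x
    + (h ^ 5 / 720) *\<^sub>R smooth_field.avf5 f x w"
proof -
  interpret smooth_field f by standard (rule f)
  have lin: "matrix g *v w = g w" if "linear g" for g :: "real ^ 'n \<Rightarrow> real ^ 'n"
    by (rule fun_cong[OF matrix_vector_mul(2)[OF that]])
  have l: "linear (\<lambda>w. D (us @ g w # vs) x)" if "linear g" for us vs g
    using linear_compose[OF that linear_mderiv[OF smooth, of us vs x]] by (simp add: o_def)
  note l1 = l[of _ "[]", simplified]
  have id: "linear (\<lambda>w::real ^ 'n. w)" by (rule linear_ident)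
  show ?thesis
    unfolding avf6_matrix_def avf_A0_def avf_A1_def avf_A2_def avf_A3_def avf_A4_def avf_A5_def
      avf_A6_def avf_A7_def avf_A8_def Let_def avf5_def
    by (simp only: matrix_vector_mult_add_rdistrib matrix_vector_mult_diff_rdistrib
        scaleR_matrix_vector_assoc[symmetric] matrix_vector_mul_lid lin l1 id)
qed

theorem theorem4p3:
  fixes f :: "real ^ 'n \<Rightarrow> real ^ 'n"
    and z0 :: "real ^ 'n"
    and \<phi> \<Phi> :: "real \<Rightarrow> real ^ 'n"
  assumes "smooth_on UNIV f"
    and "exact_solution f z0 \<phi>"
    and "avf6_solution f z0 \<Phi>"
  shows "(\<lambda>h. norm (\<Phi> h - \<phi> h)) \<in> O[at 0](\<lambda>h. h ^ 7)"
proof -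
  interpret field_solution f \<phi>
    using assms(1,2) by unfold_locales (auto simp: exact_solution_def)
  have z0: "z0 = \<phi> 0"
    using assms(2) by (simp add: exact_solution_def)
  obtain \<epsilon> where \<epsilon>: "\<epsilon> > 0" "smooth_on {-\<epsilon><..<\<epsilon>} \<Phi>" "\<Phi> 0 = z0"
    and eq: "\<And>h. h \<in> {-\<epsilon><..<\<epsilon>} \<Longrightarrow> avf6_equation f h z0 (\<Phi> h)"
    using assms(3) unfolding avf6_solution_def by blast
  \<comment> \<open>The empty list of directions yields differentiability of \<Phi> itself; the
    resulting continuity puts \<open>\<Phi> h\<close> into the ball of the Lipschitz
    estimate.\<close>
  have "mderiv \<Phi> [] differentiable (at 0)"
    using \<epsilon>(1,2) unfolding smooth_on_def by (metis greaterThanLessThan_iff neg_less_0_iff_less)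
  moreover have "mderiv \<Phi> [] = \<Phi>"
    by (rule ext) simp
  ultimately have "isCont \<Phi> 0"
    by (simp add: differentiable_imp_continuous_within)
  then have "(\<Phi> \<longlongrightarrow> \<phi> 0) (at 0)"
    by (simp add: isCont_def \<epsilon>(3) z0)
  moreover have "\<forall>\<^sub>F h in at 0. h \<in> {-\<epsilon><..<\<epsilon>}"
    by (rule eventually_at_in_open') (use \<epsilon>(1) in auto)
  then have "\<forall>\<^sub>F h in at 0. \<Phi> h = \<phi> 0 + avf_step (\<phi> 0) h (\<Phi> h)"
  proof eventually_elim
    case (elim h)
    show ?case
      using eq[OF elim] unfolding avf6_equation_def avf6_matrix_mult[OF smooth] z0 avf_step_def Let_def .
  qed
  ultimately show ?thesis
    by (rule step_solution_error)
qed

end
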